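(* Let $L\ge2$, $Q(x)=\sum_{l=2}^Lx^l$, $\|u_0\|=\|u_0\|_{C(\overline\Omega\times\partial\Omega)}$, and $$\mu = k^2\sup_{x\in\Omega}\int_\Omega |G(x,y)|\,dy,\qquad \nu=\frac{L}{L-1}\|u_0\|,\qquad K=(L-1)\,\frac{Q\big(\frac{L}{L-1}\|u_0\|\big)}{\|u_0\|}.$$ Consider the inverse Born series $\sum_{m\ge1}\mathcal{K}_m(\phi)$, $\phi\in C(\partial\Omega\times\partial\Omega)$, for the polynomial problem $\Delta u+k^2u+k^2\sum_{l=2}^L\beta^{(l)}u^l=0$ with unknown $\vec\beta=(\beta^{(2)},\dots,\beta^{(L)})$, and let $\|\mathcal{K}_1\|$ be the operator norm of $\mathcal{K}_1:C(\partial\Omega\times\partial\Omega)\to[L^\infty(\Omega)]^{L-1}$. Set $$C=\max\{2,\ \|\mathcal{K}_1\|\,\nu K\mu\},\qquad r=\frac{1}{2K\mu}\Big[\sqrt{16C^2+1}-4C\Big].$$ If $\|\mathcal{K}_1\phi\|_\infty<r$, then the inverse Born series converges in $[L^\infty(\Omega)]^{L-1}$.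
   Context: Setting. $\Omega\subset\mathbb{R}^d$, $d\ge 2$, is a bounded domain with smooth boundary, and $k$ is real such that $-k^2$ is not a Neumann eigenvalue of the Laplacian on $\Omega$. $G$ is the Neumann Green's function: $\Delta_x G(x,y)+k^2G(x,y)=\delta(x-y)$ in $\Omega$ with zero normal derivative on $\partial\Omega$. The nonlinear problem is $\Delta u+k^2u+k^2\sum_{l=2}^L\beta^{(l)}(x)u^l=0$ in $\Omega$, $\partial u/\partial\nu=g$ on $\partial\Omega$ (here $\partial/\partial\nu$ is the outward normal derivative), with real coefficients $\vec\beta=(\beta^{(2)},\dots,\beta^{(L)})\in[L^\infty(\Omega)]^{L-1}$, normed by $\|\vec\beta\|_\infty=\max_l\|\beta^{(l)}\|_\infty$. A family of real sources $g=g_s$ indexed by $s\in\partial\Omega$ is used; $u_0(\cdot,s)$ is the solution of the linear problem $\Delta u_0+k^2u_0=0$ in $\Omega$, $\partial u_0/\partial\nu=g_s$ on $\partial\Omega$, and $u_0$ is viewed as a function in $C(\overline\Omega\times\partial\Omega)$, not identically zero. Forward operators. For $v\in C(\overline\Omega\times\partial\Omega)$ put $b^{(l)}(v,\vec\beta)(x,s)=-k^2\int_\Omega G(x,y)\beta^{(l)}(y)v(y,s)\,dy$. For a multilinear operator $T$ of order $q$ (taking $q$ vectors $\vec\beta_j$, with values in functions of $(x,s)$), $B^{(l)}T(\vec\beta_1,\dots,\vec\beta_{q+1})=b^{(l)}(T(\vec\beta_1,\dots,\vec\beta_q),\vec\beta_{q+1})$. The tensor product of multilinear operators $T,S$ of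 orders $p,q$ is $T\otimes S(\vec\beta_1,\dots,\vec\beta_{p+q})=T(\vec\beta_1,\dots,\vec\beta_p)\,S(\vec\beta_{p+1},\dots,\vec\beta_{p+q})$ (pointwise product). The operators $K_n$ (of order $n$) are defined by $K_0=u_0$ and, for $n\ge0$, $$K_{n+1}=\sum_{l=2}^LB^{(l)}\sum_{\substack{i_1+\cdots+i_l=n\\0\le i_1,\dots,i_l\le n}}K_{i_1}\otimes\cdots\otimes K_{i_l}.$$ After the recursion, $K_n(\vec\beta_1,\dots,\vec\beta_n)$ is restricted to $\partial\Omega\times\partial\Omega$. Inverse operators. $\mathcal{K}_1=K_1^+$ is some fixed regularized pseudoinverse of $K_1$, a bounded linear operator $C(\partial\Omega\times\partial\Omega)\to[L^\infty(\Omega)]^{L-1}$ (no further property of it is specified). For $m\ge2$, $$\mathcal{K}_m(\phi)=-\sum_{n=2}^m\ \sum_{\substack{i_1+\cdots+i_n=m\\ i_j\ge1}}\mathcal{K}_1K_n\big(\mathcal{K}_{i_1}(\phi),\dots,\mathcal{K}_{i_n}(\phi)\big).$$ All $C(\cdot)$ norms are sup norms. *)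

theory Defs
  imports "HOL-Analysis.Analysis" "HOL-Probability.Essential_Supremum"
begin

section \<open>Differential operators and smooth domains\<close>

definition partial :: "'a::euclidean_space \<Rightarrow> ('a \<Rightarrow> real) \<Rightarrow> 'a \<Rightarrow> real" where
  "partial b f x = frechet_derivative f (at x) b"

definition grad :: "('a::euclidean_space \<Rightarrow> real) \<Rightarrow> 'a \<Rightarrow> 'a" where
  "grad f x = (\<Sum>b\<in>Basis. partial b f x *\<^sub>R b)"

definition laplacian :: "('a::euclidean_space \<Rightarrow> real) \<Rightarrow> 'a \<Rightarrow> real" where
  "laplacian f x = (\<Sum>b\<in>Basis. partial b (partial b f) x)"

text \<open>Class \<open>C\<^sup>m\<close> on a set \<open>U\<close>, which is always open in the sequel.\<close>

primrec Cm_on :: "nat \<Rightarrow> 'a::euclidean_space set \<Rightarrow> ('a \<Rightarrow> real) \<Rightarrow> bool" where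
  "Cm_on 0 U f \<longleftrightarrow> continuous_on U f"
| "Cm_on (Suc m) U f \<longleftrightarrow> f differentiable_on U \<and> (\<forall>b\<in>Basis. Cm_on m U (partial b f))"

definition smooth_on :: "'a::euclidean_space set \<Rightarrow> ('a \<Rightarrow> real) \<Rightarrow> bool" where
  "smooth_on U f \<longleftrightarrow> (\<forall>m. Cm_on m U f)"

definition defining_function ::
    "'a::euclidean_space set \<Rightarrow> 'a \<Rightarrow> 'a set \<Rightarrow> ('a \<Rightarrow> real) \<Rightarrow> bool" where
  "defining_function \<Omega> p U \<rho> \<longleftrightarrow>
     open U \<and> p \<in> U \<and> smooth_on U \<rho> \<and> (\<forall>x\<in>U. grad \<rho> x \<noteq> 0) \<and>
     \<Omega> \<inter> U = {x\<in>U. \<rho> x < 0} \<and> frontier \<Omega> \<inter> U = {x\<in>U. \<rho> x = 0}"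

definition smooth_bounded_domain :: "'a::euclidean_space set \<Rightarrow> bool" where
  "smooth_bounded_domain \<Omega> \<longleftrightarrow>
     open \<Omega> \<and> connected \<Omega> \<and> bounded \<Omega> \<and> \<Omega> \<noteq> {} \<and>
     (\<forall>p\<in>frontier \<Omega>. \<exists>U \<rho>. defining_function \<Omega> p U \<rho>)"

definition outward_unit_normal :: "'a::euclidean_space set \<Rightarrow> 'a \<Rightarrow> 'a \<Rightarrow> bool" where
  "outward_unit_normal \<Omega> p n \<longleftrightarrow>
     (\<exists>U \<rho>. defining_function \<Omega> p U \<rho> \<and> n = grad \<rho> p /\<^sub>R norm (grad \<rho> p))"

text \<open>The outward normal derivative at a boundary point \<open>p\<close> is one-sided, since \<open>f\<close> is only
  meaningful on \<open>closure \<Omega>\<close>.\<close>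

definition has_normal_derivative ::
    "'a::euclidean_space set \<Rightarrow> ('a \<Rightarrow> real) \<Rightarrow> 'a \<Rightarrow> real \<Rightarrow> bool" where
  "has_normal_derivative \<Omega> f p D \<longleftrightarrow>
     (\<exists>n. outward_unit_normal \<Omega> p n \<and>
          ((\<lambda>t. (f p - f (p - t *\<^sub>R n)) / t) \<longlongrightarrow> D) (at_right 0))"

section \<open>The linear Neumann problem and the Neumann Green's function\<close>

definition neumann_eigenvalue :: "'a::euclidean_space set \<Rightarrow> real \<Rightarrow> bool" where
  "neumann_eigenvalue \<Omega> ev \<longleftrightarrow>
     (\<exists>w. continuous_on (closure \<Omega>) w \<and> Cm_on 2 \<Omega> w \<and> (\<exists>x\<in>\<Omega>. w x \<noteq> 0) \<and>
          (\<forall>x\<in>\<Omega>. laplacian w x = ev * w x) \<and>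
          (\<forall>p\<in>frontier \<Omega>. has_normal_derivative \<Omega> w p 0))"

definition solves_linear_problem ::
    "'a::euclidean_space set \<Rightarrow> real \<Rightarrow> ('a \<Rightarrow> real) \<Rightarrow> ('a \<Rightarrow> real) \<Rightarrow> bool" where
  "solves_linear_problem \<Omega> k h u \<longleftrightarrow>
     continuous_on (closure \<Omega>) u \<and> Cm_on 2 \<Omega> u \<and>
     (\<forall>x\<in>\<Omega>. laplacian u x + k\<^sup>2 * u x = 0) \<and>
     (\<forall>p\<in>frontier \<Omega>. has_normal_derivative \<Omega> u p (h p))"

definition test_function :: "'a::euclidean_space set \<Rightarrow> ('a \<Rightarrow> real) \<Rightarrow> bool" where
  "test_function \<Omega> \<phi> \<longleftrightarrow>
     smooth_on UNIV \<phi> \<and> (\<exists>S. compact S \<and> S \<subseteq> \<Omega> \<and> (\<forall>x. x \<notin> S \<longrightarrow> \<phi> x = 0))"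

text \<open>The equation \<open>\<Delta>\<^sub>x G(x,y) + k\<^sup>2 G(x,y) = \<delta>(x - y)\<close> is meant in the sense of distributions, which
  by itself determines \<open>G(\<cdot>,y)\<close> only almost everywhere.  The first two clauses select the usual
  classical representative: continuous up to the boundary off the diagonal and weakly singular
  on it.  For the Neumann function of a smooth bounded domain one can take \<open>\<alpha> = d - 2\<close> if \<open>d \<ge> 3\<close>
  and any \<open>\<alpha> > 0\<close> (logarithmic singularity) if \<open>d = 2\<close>.\<close>

definition neumann_green :: "'a::euclidean_space set \<Rightarrow> real \<Rightarrow> ('a \<Rightarrow> 'a \<Rightarrow> real) \<Rightarrow> bool" where
  "neumann_green \<Omega> k G \<longleftrightarrow>
     continuous_on {(x, y). x \<in> closure \<Omega> \<and> y \<in> \<Omega> \<and> x \<noteq> y} (\<lambda>(x, y). G x y) \<and>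
     (\<exists>A \<alpha>. \<alpha> < real DIM('a) \<and>
        (\<forall>x\<in>closure \<Omega>. \<forall>y\<in>\<Omega>. x \<noteq> y \<longrightarrow> \<bar>G x y\<bar> \<le> A * dist x y powr (- \<alpha>))) \<and>
     (\<forall>y\<in>\<Omega>. \<forall>\<phi>. test_function \<Omega> \<phi> \<longrightarrow>
        (LINT x|lebesgue_on \<Omega>. G x y * (laplacian \<phi> x + k\<^sup>2 * \<phi> x)) = \<phi> y) \<and>
     (\<forall>y\<in>\<Omega>. \<forall>p\<in>frontier \<Omega>. has_normal_derivative \<Omega> (\<lambda>x. G x y) p 0)"

section \<open>The spaces \<open>C(S)\<close> and \<open>[L\<^sup>\<infinity>(\<Omega>)]\<^bsup>L-1\<^esup>\<close>\<close>

text \<open>Elements of \<open>C(S)\<close>, \<open>S\<close> compact, are functions on the whole type satisfying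
  \<open>continuous_on S\<close>; values outside \<open>S\<close> do not matter.\<close>

definition C_norm :: "'b set \<Rightarrow> ('b \<Rightarrow> real) \<Rightarrow> real" where
  "C_norm S f = (SUP p\<in>S. \<bar>f p\<bar>)"

text \<open>A coefficient vector is represented by a function \<open>\<beta>\<close>, with \<open>\<beta> l\<close> the coefficient of \<open>u\<^sup>l\<close>;
  only the indices \<open>2 \<le> l \<le> L\<close> and the values on \<open>\<Omega>\<close> matter.\<close>

type_synonym 'a coeffs = "nat \<Rightarrow> 'a \<Rightarrow> real"

definition Linf :: "'a::euclidean_space set \<Rightarrow> nat \<Rightarrow> 'a coeffs set" where
  "Linf \<Omega> L = {\<beta>. \<forall>l\<in>{2..L}. \<beta> l \<in> borel_measurable (lebesgue_on \<Omega>) \<and>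
                    esssup (lebesgue_on \<Omega>) (\<lambda>x. ereal \<bar>\<beta> l x\<bar>) < \<infinity>}"

definition Linf_norm :: "'a::euclidean_space set \<Rightarrow> nat \<Rightarrow> 'a coeffs \<Rightarrow> real" where
  "Linf_norm \<Omega> L \<beta> =
     Max ((\<lambda>l. real_of_ereal (esssup (lebesgue_on \<Omega>) (\<lambda>x. ereal \<bar>\<beta> l x\<bar>))) ` {2..L})"

definition Linf_eq :: "'a::euclidean_space set \<Rightarrow> nat \<Rightarrow> 'a coeffs \<Rightarrow> 'a coeffs \<Rightarrow> bool" where
  "Linf_eq \<Omega> L \<beta> \<gamma> \<longleftrightarrow> (\<forall>l\<in>{2..L}. AE x in lebesgue_on \<Omega>. \<beta> l x = \<gamma> l x)"

text \<open>Convergence in norm of the series \<open>\<Sum>\<^sub>m\<^sub>\<ge>\<^sub>1 a\<^sub>m\<close>.  Membership of the terms is required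
  explicitly because \<open>Linf_norm\<close> is only meaningful on \<open>Linf\<close>.\<close>

definition Linf_series_converges ::
    "'a::euclidean_space set \<Rightarrow> nat \<Rightarrow> (nat \<Rightarrow> 'a coeffs) \<Rightarrow> bool" where
  "Linf_series_converges \<Omega> L a \<longleftrightarrow>
     (\<forall>m\<ge>1. a m \<in> Linf \<Omega> L) \<and>
     (\<exists>\<beta>\<in>Linf \<Omega> L. (\<lambda>N. Linf_norm \<Omega> L (\<lambda>l x. (\<Sum>m=1..N. a m l x) - \<beta> l x)) \<longlonglongrightarrow> 0)"

text \<open>Bounded linear operators \<open>C(\<partial>\<Omega> \<times> \<partial>\<Omega>) \<rightarrow> [L\<^sup>\<infinity>(\<Omega>)]\<^bsup>L-1\<^esup>\<close>, on representatives: linearity holds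
  almost everywhere, and linearity and boundedness together force \<open>T \<phi>\<close> to depend, up to null sets,
  only on the restriction of \<open>\<phi>\<close> to \<open>\<partial>\<Omega> \<times> \<partial>\<Omega>\<close>.\<close>

definition bounded_linear_C_Linf ::
    "'a::euclidean_space set \<Rightarrow> nat \<Rightarrow> (('a \<times> 'a \<Rightarrow> real) \<Rightarrow> 'a coeffs) \<Rightarrow> bool" where
  "bounded_linear_C_Linf \<Omega> L T \<longleftrightarrow>
     (let S = frontier \<Omega> \<times> frontier \<Omega> in
       (\<forall>\<phi>. continuous_on S \<phi> \<longrightarrow> T \<phi> \<in> Linf \<Omega> L) \<and>
       (\<forall>\<phi> \<psi>. continuous_on S \<phi> \<longrightarrow> continuous_on S \<psi> \<longrightarrow>
          Linf_eq \<Omega> L (T (\<lambda>p. \<phi> p + \<psi> p)) (\<lambda>l x. T \<phi> l x + T \<psi> l x)) \<and>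
       (\<forall>c \<phi>. continuous_on S \<phi> \<longrightarrow>
          Linf_eq \<Omega> L (T (\<lambda>p. c * \<phi> p)) (\<lambda>l x. c * T \<phi> l x)) \<and>
       (\<exists>M. \<forall>\<phi>. continuous_on S \<phi> \<longrightarrow> Linf_norm \<Omega> L (T \<phi>) \<le> M * C_norm S \<phi>))"

definition op_norm_C_Linf ::
    "'a::euclidean_space set \<Rightarrow> nat \<Rightarrow> (('a \<times> 'a \<Rightarrow> real) \<Rightarrow> 'a coeffs) \<Rightarrow> real" where
  "op_norm_C_Linf \<Omega> L T =
     (let S = frontier \<Omega> \<times> frontier \<Omega> in
       SUP \<phi>\<in>{\<phi>. continuous_on S \<phi> \<and> C_norm S \<phi> \<le> 1}. Linf_norm \<Omega> L (T \<phi>))"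

section \<open>Forward and inverse operators\<close>

text \<open>A multilinear operator of order \<open>q\<close> takes a list of \<open>q\<close> coefficient vectors to a function of
  \<open>(x, s)\<close>.\<close>

type_synonym 'a multi_op = "'a coeffs list \<Rightarrow> 'a \<times> 'a \<Rightarrow> real"

definition b_op :: "'a::euclidean_space set \<Rightarrow> real \<Rightarrow> ('a \<Rightarrow> 'a \<Rightarrow> real) \<Rightarrow> nat \<Rightarrow>
    ('a \<times> 'a \<Rightarrow> real) \<Rightarrow> 'a coeffs \<Rightarrow> 'a \<times> 'a \<Rightarrow> real" where
  "b_op \<Omega> k G l v \<beta> = (\<lambda>(x, s). - k\<^sup>2 * (LINT y|lebesgue_on \<Omega>. G x y * \<beta> l y * v (y, s)))"

definition B_op :: "'a::euclidean_space set \<Rightarrow> real \<Rightarrow> ('a \<Rightarrow> 'a \<Rightarrow> real) \<Rightarrow> nat \<Rightarrow>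
    'a multi_op \<Rightarrow> 'a multi_op" where
  "B_op \<Omega> k G l T = (\<lambda>\<beta>s. b_op \<Omega> k G l (T (butlast \<beta>s)) (last \<beta>s))"

text \<open>Tensor product of operators, each paired with its order.  The empty product is the constant
  \<open>1\<close> of order \<open>0\<close>, the unit of the tensor product.\<close>

primrec tensor :: "(nat \<times> 'a multi_op) list \<Rightarrow> 'a multi_op" where
  "tensor [] = (\<lambda>\<beta>s q. 1)"
| "tensor (T # Ts) =
     (\<lambda>\<beta>s q. snd T (take (fst T) \<beta>s) q * tensor Ts (drop (fst T) \<beta>s) q)"

definition index_tuples :: "nat \<Rightarrow> nat \<Rightarrow> nat list set" where
  "index_tuples l n = {is. length is = l \<and> sum_list is = n \<and> (\<forall>i\<in>set is. i \<le> n)}"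

definition pos_index_tuples :: "nat \<Rightarrow> nat \<Rightarrow> nat list set" where
  "pos_index_tuples n m = {is. length is = n \<and> sum_list is = m \<and> (\<forall>i\<in>set is. 1 \<le> i)}"

lemma pos_index_tuples_less:
  assumes "is \<in> pos_index_tuples n m" "2 \<le> n" "i \<in> set is"
  shows "i < m"
proof -
  obtain xs ys where s: "is = xs @ i # ys"
    using assms(3) by (meson split_list)
  have len: "length zs \<le> sum_list zs" if "\<forall>i\<in>set zs. 1 \<le> i" for zs :: "nat list"
    using that by (induction zs) auto
  have "length (xs @ ys) \<le> sum_list (xs @ ys)"
    using assms(1) s by (intro len) (auto simp: pos_index_tuples_def)
  moreover have "length (xs @ ys) \<ge> 1" and "sum_list (xs @ ys) + i = m"
    using assms(1,2) s by (auto simp: pos_index_tuples_def)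
  ultimately show ?thesis by linarith
qed

function born_op :: "'a::euclidean_space set \<Rightarrow> real \<Rightarrow> ('a \<Rightarrow> 'a \<Rightarrow> real) \<Rightarrow> nat \<Rightarrow>
    ('a \<times> 'a \<Rightarrow> real) \<Rightarrow> nat \<Rightarrow> 'a multi_op" where
  "born_op \<Omega> k G L u0 0 = (\<lambda>\<beta>s. u0)"
| "born_op \<Omega> k G L u0 (Suc n) =
     (\<lambda>\<beta>s q. \<Sum>l=2..L. B_op \<Omega> k G l
        (\<lambda>\<gamma>s q'. \<Sum>is\<in>index_tuples l n.
            tensor (map (\<lambda>i. (i, born_op \<Omega> k G L u0 i)) is) \<gamma>s q') \<beta>s q)"
  by pat_completeness auto
termination
  by (relation "Wellfounded.measure (\<lambda>(\<Omega>, k, G, L, u0, n). n)") (auto simp: index_tuples_def)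

text \<open>\<open>inv_born_op \<dots> T m \<phi>\<close> is the \<open>m\<close>-th inverse operator applied to \<open>\<phi>\<close>, where \<open>T\<close> is the chosen
  pseudoinverse of the first forward operator.  The value at \<open>m = 0\<close> is not used.\<close>

function inv_born_op :: "'a::euclidean_space set \<Rightarrow> real \<Rightarrow> ('a \<Rightarrow> 'a \<Rightarrow> real) \<Rightarrow> nat \<Rightarrow>
    ('a \<times> 'a \<Rightarrow> real) \<Rightarrow> (('a \<times> 'a \<Rightarrow> real) \<Rightarrow> 'a coeffs) \<Rightarrow> nat \<Rightarrow>
    ('a \<times> 'a \<Rightarrow> real) \<Rightarrow> 'a coeffs" where
  "inv_born_op \<Omega> k G L u0 T 0 \<phi> = (\<lambda>l x. 0)"
| "inv_born_op \<Omega> k G L u0 T (Suc 0) \<phi> = T \<phi>"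
| "inv_born_op \<Omega> k G L u0 T (Suc (Suc m)) \<phi> =
     (\<lambda>l x. - (\<Sum>n=2..Suc (Suc m). \<Sum>is\<in>pos_index_tuples n (Suc (Suc m)).
        T (restrict (born_op \<Omega> k G L u0 n (map (\<lambda>i. inv_born_op \<Omega> k G L u0 T i \<phi>) is))
             (frontier \<Omega> \<times> frontier \<Omega>)) l x))"
  by pat_completeness auto
termination
  by (relation "Wellfounded.measure (\<lambda>(\<Omega>, k, G, L, u0, T, m, \<phi>). m)")
     (auto dest: pos_index_tuples_less)

end

theory Submission
  imports Defs
begin

text \<open>
  The forward operators obey a scalar recursion.  One application of \<open>b\<^bsup>(l)\<^esup>\<close> costs a factor
  \<open>\<mu> \<parallel>\<beta>\<parallel>\<close>, so the norms of the \<open>K\<^sub>n\<close> are dominated by the coefficients \<open>k\<^sub>n\<close> of the power series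
  solving \<open>k(x) = U + \<mu> x Q(k(x))\<close> (\<open>born_op_bounded\<close>, \<open>majorant\<close>).  The number \<open>\<nu>\<close> solves this
  fixed-point equation at \<open>x = 1 / (K \<mu>)\<close>; as all coefficients are nonnegative, the partial sums
  there stay below \<open>\<nu>\<close>, and therefore \<open>k\<^sub>n \<le> \<nu> (K \<mu>)\<^sup>n\<close> (\<open>majorant_le\<close>).

  Insert this into the inverse recursion and write \<open>b\<^sub>m = K \<mu> \<parallel>\<K>\<^sub>m(\<phi>)\<parallel>\<close>.  Then \<open>b\<^sub>m\<close> is at most \<open>C\<close>
  times the sum of all products \<open>b\<^bsub>i\<^sub>1\<^esub> \<dots> b\<^bsub>i\<^sub>n\<^esub>\<close> with \<open>n \<ge> 2\<close> and \<open>i\<^sub>1 + \<dots> + i\<^sub>n = m\<close>, which says that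
  the formal sum \<open>b\<close> of the \<open>b\<^sub>m\<close> is dominated by \<open>b\<^sub>1 + C b\<^sup>2 / (1 - b)\<close>.  Hence any \<open>y < 1\<close> with
  \<open>b\<^sub>1 + C y\<^sup>2 / (1 - y) \<le> y\<close> bounds all partial sums of the \<open>b\<^sub>m\<close>
  (\<open>inverse_majorant_partial_sum_le\<close>).  The hypothesis on \<open>\<phi>\<close> gives \<open>b\<^sub>1 \<le> 1 / (16 C)\<close>, and then
  \<open>y = 1 / (4 C)\<close> qualifies.  So the series converges absolutely, and \<open>L\<^sup>\<infinity>\<close> is complete
  (\<open>Linf_series_convergesI\<close>).

  The analytic point is that the recursion is meaningful with \<open>\<mu>\<close> as its constant: every \<open>K\<^sub>n\<close> must
  again be continuous on \<open>closure \<Omega> \<times> frontier \<Omega>\<close>, and \<open>\<mu>\<close>, a supremum over the open set \<open>\<Omega>\<close>, must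
  control boundary points as well.  Both follow from the continuity of weakly singular integral
  operators up to the boundary (\<open>kernel_integral_tendsto\<close>).
\<close>


section \<open>Majorants of the two series\<close>

lemma sum_prod_list_lists:
  fixes c :: "'b \<Rightarrow> real"
  assumes "finite A"
  shows "(\<Sum>is\<in>{is. set is \<subseteq> A \<and> length is = l}. prod_list (map c is)) = (sum c A) ^ l"
proof (induction l)
  case 0
  have "{is. set is \<subseteq> A \<and> length is = 0} = {[]}"
    by auto
  then show ?case
    by simp
next
  case (Suc l)
  let ?X = "{is. set is \<subseteq> A \<and> length is = l}"
  have inj: "inj_on (\<lambda>(is, i). i # is) (?X \<times> A)"
    by (auto simp: inj_on_def)
  have "(\<Sum>is\<in>{is. set is \<subseteq> A \<and> length is = Suc l}. prod_list (map c is)) =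
      (\<Sum>(is, i)\<in>?X \<times> A. prod_list (map c is) * c i)"
    unfolding lists_length_Suc_eq sum.reindex[OF inj]
    by (intro sum.cong) (auto simp: mult.commute)
  also have "\<dots> = (\<Sum>is\<in>?X. prod_list (map c is)) * sum c A"
    by (simp add: sum_product sum.cartesian_product)
  finally show ?case
    using Suc by simp
qed

text \<open>This is how a power of a truncated generating function dominates the truncated convolution
  sums: the \<open>X n\<close> are the index tuples of total weight \<open>n\<close>.\<close>

lemma sum_disjoint_prod_lists_le_power:
  fixes c :: "'b \<Rightarrow> real"
  assumes A: "finite A" "\<And>i. i \<in> A \<Longrightarrow> 0 \<le> c i"
    and I: "finite I"
    and X: "\<And>n is. n \<in> I \<Longrightarrow> is \<in> X n \<Longrightarrow> length is = l \<and> set is \<subseteq> A"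
    and disj: "\<And>m n is. is \<in> X m \<Longrightarrow> is \<in> X n \<Longrightarrow> m = n"
  shows "(\<Sum>n\<in>I. \<Sum>is\<in>X n. prod_list (map c is)) \<le> (sum c A) ^ l"
proof -
  let ?Y = "{is. set is \<subseteq> A \<and> length is = l}"
  have fin: "finite ?Y"
    using A(1) by (rule finite_lists_length_eq)
  have sub: "X n \<subseteq> ?Y" if "n \<in> I" for n
    using X[OF that] by auto
  have "(\<Sum>n\<in>I. \<Sum>is\<in>X n. prod_list (map c is)) = (\<Sum>is\<in>(\<Union>n\<in>I. X n). prod_list (map c is))"
    using I fin sub disj
    by (intro sum.UNION_disjoint[symmetric]) (auto intro: finite_subset[OF sub])
  also have "\<dots> \<le> (\<Sum>is\<in>?Y. prod_list (map c is))"
  proof (intro sum_mono2 fin)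
    show "(\<Union>n\<in>I. X n) \<subseteq> ?Y"
      using sub by (rule UN_least)
    show "0 \<le> prod_list (map c is)" if "is \<in> ?Y - (\<Union>n\<in>I. X n)" for "is"
      using that A(2) by (intro prod_list_nonneg) auto
  qed
  also have "\<dots> = (sum c A) ^ l"
    using A(1) by (rule sum_prod_list_lists)
  finally show ?thesis .
qed

lemma prod_list_map_mult_power:
  fixes f :: "nat \<Rightarrow> real"
  shows "prod_list (map (\<lambda>i. f i * x ^ i) is) = prod_list (map f is) * x ^ sum_list is"
  by (induction "is") (auto simp: power_add)

text \<open>The coefficients of the power series \<open>k(x)\<close> solving \<open>k(x) = U + \<mu> x Q(k(x))\<close>, written with the
  same index tuples as the forward operators so that the two recursions match term by term.\<close>

function majorant :: "nat \<Rightarrow> real \<Rightarrow> real \<Rightarrow> nat \<Rightarrow> real" where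
  "majorant L \<mu> U 0 = U"
| "majorant L \<mu> U (Suc n) =
     \<mu> * (\<Sum>l=2..L. \<Sum>is\<in>index_tuples l n. prod_list (map (majorant L \<mu> U) is))"
  by pat_completeness auto
termination
  by (relation "Wellfounded.measure (\<lambda>(L, \<mu>, U, n). n)") (auto simp: index_tuples_def)

lemma majorant_nonneg:
  assumes "0 \<le> \<mu>" "0 \<le> U"
  shows "0 \<le> majorant L \<mu> U n"
proof (induction n rule: less_induct)
  case (less n)
  then show ?case
  proof (cases n)
    case (Suc m)
    have "0 \<le> prod_list (map (majorant L \<mu> U) is)" if "is \<in> index_tuples l m" for l "is"
      using that less by (intro prod_list_nonneg) (auto simp: index_tuples_def Suc)
    then show ?thesis
      using assms by (auto simp: Suc intro!: mult_nonneg_nonneg sum_nonneg)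
  qed (use assms in simp)
qed

text \<open>A supersolution \<open>V\<close> of the fixed-point equation at \<open>x\<close> bounds all partial sums of \<open>k(x)\<close>,
  because each partial sum is dominated by the right-hand side evaluated at the previous one.\<close>

lemma majorant_partial_sum_le:
  assumes \<mu>: "0 \<le> \<mu>" and U: "0 \<le> U" and x: "0 \<le> x"
    and V: "U + x * \<mu> * (\<Sum>l=2..L. V ^ l) \<le> V" "U \<le> V"
  shows "(\<Sum>n\<le>N. majorant L \<mu> U n * x ^ n) \<le> V"
proof (induction N)
  case 0
  then show ?case
    using V(2) by simp
next
  case (Suc N)
  let ?k = "majorant L \<mu> U"
  let ?S = "\<Sum>n\<le>N. ?k n * x ^ n"
  have nn: "0 \<le> ?k n * x ^ n" for n
    using majorant_nonneg[OF \<mu> U] x by simp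
  have conv: "(\<Sum>n\<le>N. \<Sum>is\<in>index_tuples l n. prod_list (map (\<lambda>i. ?k i * x ^ i) is)) \<le> V ^ l" for l
  proof -
    have "(\<Sum>n\<le>N. \<Sum>is\<in>index_tuples l n. prod_list (map (\<lambda>i. ?k i * x ^ i) is)) \<le> ?S ^ l"
      using nn by (intro sum_disjoint_prod_lists_le_power) (auto simp: index_tuples_def)
    also have "\<dots> \<le> V ^ l"
      using Suc nn by (intro power_mono sum_nonneg) auto
    finally show ?thesis .
  qed
  have "(\<Sum>n\<le>Suc N. ?k n * x ^ n) = U + (\<Sum>n\<le>N. ?k (Suc n) * x ^ Suc n)"
    by (subst sum.atMost_Suc_shift) simp
  also have "(\<Sum>n\<le>N. ?k (Suc n) * x ^ Suc n) =
      (\<Sum>n\<le>N. x * \<mu> * (\<Sum>l=2..L. \<Sum>is\<in>index_tuples l n. prod_list (map (\<lambda>i. ?k i * x ^ i) is)))"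
  proof (intro sum.cong refl)
    fix n
    have "(\<Sum>is\<in>index_tuples l n. prod_list (map (\<lambda>i. ?k i * x ^ i) is)) =
        (\<Sum>is\<in>index_tuples l n. prod_list (map ?k is)) * x ^ n" for l
      unfolding sum_distrib_right prod_list_map_mult_power
      by (intro sum.cong) (auto simp: index_tuples_def)
    then show "?k (Suc n) * x ^ Suc n =
        x * \<mu> * (\<Sum>l=2..L. \<Sum>is\<in>index_tuples l n. prod_list (map (\<lambda>i. ?k i * x ^ i) is))"
      by (simp add: sum_distrib_right[symmetric])
  qed
  also have "\<dots> =
      x * \<mu> * (\<Sum>l=2..L. \<Sum>n\<le>N. \<Sum>is\<in>index_tuples l n. prod_list (map (\<lambda>i. ?k i * x ^ i) is))"
    by (subst sum.swap) (simp only: sum_distrib_left[symmetric])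
  also have "U + \<dots> \<le> U + x * \<mu> * (\<Sum>l=2..L. V ^ l)"
    using x \<mu> by (intro add_left_mono mult_left_mono sum_mono conv) auto
  also have "\<dots> \<le> V"
    by (rule V(1))
  finally show ?case .
qed

text \<open>Nonnegative coefficients: a bound for the partial sums at \<open>x\<close> bounds each single term.\<close>

lemma majorant_le:
  assumes \<mu>: "0 \<le> \<mu>" and U: "0 \<le> U" and x: "0 < x"
    and V: "U + x * \<mu> * (\<Sum>l=2..L. V ^ l) \<le> V" "U \<le> V"
  shows "majorant L \<mu> U n \<le> V * (1 / x) ^ n"
proof -
  have "majorant L \<mu> U n * x ^ n \<le> (\<Sum>n\<le>n. majorant L \<mu> U n * x ^ n)"
    using majorant_nonneg[OF \<mu> U] x by (intro member_le_sum) auto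
  also have "\<dots> \<le> V"
    using assms by (intro majorant_partial_sum_le) auto
  finally show ?thesis
    using x by (simp add: field_simps power_divide)
qed

text \<open>The same argument for the inverse recursion: with equality in \<open>rec\<close> the generating function would
  satisfy \<open>b(t) = b\<^sub>1 t + C b(t)\<^sup>2 / (1 - b(t))\<close>, and \<open>y\<close> is a supersolution of this equation at
  \<open>t = 1\<close>.  All indices in a tuple of length at least \<open>2\<close> are smaller than their sum, so the next partial
  sum only involves the previous one.\<close>

lemma inverse_majorant_partial_sum_le:
  fixes b :: "nat \<Rightarrow> real"
  assumes b: "\<And>m. 0 \<le> b m" and C: "0 \<le> C"
    and rec: "\<And>m. 2 \<le> m \<Longrightarrow>
      b m \<le> C * (\<Sum>n=2..m. \<Sum>is\<in>pos_index_tuples n m. prod_list (map b is))"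
    and y: "0 \<le> y" "y < 1" "b 1 + C * (y\<^sup>2 / (1 - y)) \<le> y"
  shows "(\<Sum>m=1..M. b m) \<le> y"
proof (induction M)
  case 0
  then show ?case
    using y by simp
next
  case (Suc M)
  let ?S = "\<Sum>m=1..M. b m"
  have conv: "(\<Sum>m=2..Suc M. \<Sum>is\<in>pos_index_tuples n m. prod_list (map b is)) \<le> y ^ n"
    if n: "2 \<le> n" for n
  proof -
    have "(\<Sum>m=2..Suc M. \<Sum>is\<in>pos_index_tuples n m. prod_list (map b is)) \<le> ?S ^ n"
    proof (intro sum_disjoint_prod_lists_le_power)
      fix m "is" assume m: "m \<in> {2..Suc M}" and "is": "is \<in> pos_index_tuples n m"
      have "1 \<le> i \<and> i < m" if "i \<in> set is" for i
        using pos_index_tuples_less[OF "is" n that] "is" that by (auto simp: pos_index_tuples_def)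
      then show "length is = n \<and> set is \<subseteq> {1..M}"
        using "is" m by (force simp: pos_index_tuples_def)
    qed (use b in \<open>auto simp: pos_index_tuples_def\<close>)
    also have "\<dots> \<le> y ^ n"
      using Suc b by (intro power_mono sum_nonneg) auto
    finally show ?thesis .
  qed
  have geo: "(\<Sum>n=2..Suc M. y ^ n) \<le> y\<^sup>2 / (1 - y)"
  proof (cases "Suc M < 2")
    case False
    have "(\<Sum>n=2..Suc M. y ^ n) = (y\<^sup>2 - y ^ Suc (Suc M)) / (1 - y)"
      using False y by (subst sum_gp) auto
    also have "\<dots> \<le> y\<^sup>2 / (1 - y)"
      using y by (intro divide_right_mono) auto
    finally show ?thesis .
  qed (use y in auto)
  have "(\<Sum>m=1..Suc M. b m) = b 1 + (\<Sum>m=2..Suc M. b m)"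
    by (simp add: sum.atLeast_Suc_atMost numeral_2_eq_2)
  also have "(\<Sum>m=2..Suc M. b m) \<le>
      (\<Sum>m=2..Suc M. C * (\<Sum>n=2..m. \<Sum>is\<in>pos_index_tuples n m. prod_list (map b is)))"
    by (intro sum_mono rec) auto
  also have "\<dots> \<le>
      (\<Sum>m=2..Suc M. C * (\<Sum>n=2..Suc M. \<Sum>is\<in>pos_index_tuples n m. prod_list (map b is)))"
    using C b by (intro sum_mono mult_left_mono sum_mono2) (auto intro!: sum_nonneg prod_list_nonneg)
  also have "\<dots> = C * (\<Sum>n=2..Suc M. \<Sum>m=2..Suc M. \<Sum>is\<in>pos_index_tuples n m. prod_list (map b is))"
    unfolding sum_distrib_left[symmetric] by (subst sum.swap) (rule refl)
  also have "\<dots> \<le> C * (\<Sum>n=2..Suc M. y ^ n)"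
    using C by (intro mult_left_mono sum_mono conv) auto
  also have "\<dots> \<le> C * (y\<^sup>2 / (1 - y))"
    using C geo by (intro mult_left_mono)
  finally show ?case
    using y(3) by linarith
qed

section \<open>Weakly singular integral operators\<close>

text \<open>The total weight of the dyadic shells of the unit ball, see the next lemma.\<close>

definition riesz_constant :: "'a::euclidean_space itself \<Rightarrow> real \<Rightarrow> real" where
  "riesz_constant _ \<alpha> =
     2 powr \<alpha> * unit_ball_vol (DIM('a)) / (1 - 2 powr (\<alpha> - DIM('a)))"

text \<open>Cut the ball into the shells \<open>\<delta> 2\<^bsup>-n-1\<^esup> \<le> |x - y| < \<delta> 2\<^bsup>-n\<^esup>\<close> and bound the integrand on each
  by its value on the inner sphere; \<open>\<alpha> < d\<close> makes the resulting geometric series converge.\<close>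

lemma nn_integral_dist_powr_ball_le:
  fixes x :: "'a::euclidean_space" and \<alpha> :: real
  assumes \<alpha>: "0 \<le> \<alpha>" "\<alpha> < DIM('a)" and \<delta>: "0 < \<delta>"
  shows "(\<integral>\<^sup>+y. ennreal (dist x y powr (- \<alpha>)) * indicator (ball x \<delta>) y \<partial>lebesgue)
    \<le> ennreal (riesz_constant TYPE('a) \<alpha> * \<delta> powr (DIM('a) - \<alpha>))"
proof -
  let ?d = "real DIM('a)" and ?V = "unit_ball_vol (DIM('a))"
  let ?c = "\<lambda>n. (\<delta> / 2 ^ Suc n) powr (- \<alpha>)"
  have pw: "ennreal (dist x y powr (- \<alpha>)) * indicator (ball x \<delta>) y
      \<le> (\<Sum>n. ennreal (?c n) * indicator (ball x (\<delta> / 2 ^ n)) y)" for y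
  proof (cases "y \<in> ball x \<delta> \<and> y \<noteq> x")
    case True
    define t where "t = dist x y"
    have t: "0 < t" "t < \<delta>"
      using True by (auto simp: t_def)
    obtain N where N: "\<delta> / 2 ^ Suc N \<le> t" "t < \<delta> / 2 ^ N"
    proof -
      have "\<exists>n. \<delta> / 2 ^ n \<le> t"
      proof -
        obtain n where "\<delta> / t < 2 ^ n"
          using real_arch_pow[of 2 "\<delta> / t"] by auto
        then have "\<delta> / 2 ^ n \<le> t"
          using t by (simp add: field_simps)
        then show ?thesis ..
      qed
      define n where "n = (LEAST n. \<delta> / 2 ^ n \<le> t)"
      have n: "\<delta> / 2 ^ n \<le> t"
        unfolding n_def by (rule LeastI_ex) fact
      have "n \<noteq> 0"
        using n t by (intro notI) simp
      then obtain N where N: "n = Suc N"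
        using not0_implies_Suc by blast
      then have "\<not> \<delta> / 2 ^ N \<le> t"
        using not_less_Least[of N "\<lambda>n. \<delta> / 2 ^ n \<le> t"] by (simp add: n_def)
      then show ?thesis
        using that n N by auto
    qed
    have "ennreal (dist x y powr (- \<alpha>)) * indicator (ball x \<delta>) y \<le> ennreal (t powr (- \<alpha>))"
      using True by (simp add: t_def)
    also have "\<dots> \<le> ennreal (?c N)"
      using N \<alpha> \<delta> t by (intro ennreal_leI powr_mono2') auto
    also have "\<dots> = ennreal (?c N) * indicator (ball x (\<delta> / 2 ^ N)) y"
      using N by (simp add: t_def)
    also have "\<dots> \<le> (\<Sum>n. ennreal (?c n) * indicator (ball x (\<delta> / 2 ^ n)) y)"
    proof -
      define f where "f = (\<lambda>n. ennreal (?c n) * indicator (ball x (\<delta> / 2 ^ n)) y :: ennreal)"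
      have "f N = sum f {N}"
        by simp
      also have "\<dots> \<le> suminf f"
        by (intro sum_le_suminf) auto
      finally show ?thesis
        unfolding f_def .
    qed
    finally show ?thesis .
  next
    case False
    then have "ennreal (dist x y powr (- \<alpha>)) * indicator (ball x \<delta>) y = 0"
      by (auto simp: indicator_def)
    then show ?thesis
      by (simp only: zero_le)
  qed
  have q: "2 powr (\<alpha> - ?d) < 1"
    using \<alpha> by (simp add: powr_less_one)
  have "(\<integral>\<^sup>+y. ennreal (dist x y powr (- \<alpha>)) * indicator (ball x \<delta>) y \<partial>lebesgue)
      \<le> (\<integral>\<^sup>+y. (\<Sum>n. ennreal (?c n) * indicator (ball x (\<delta> / 2 ^ n)) y) \<partial>lebesgue)"
    by (intro nn_integral_mono pw)
  also have "\<dots> = (\<Sum>n. \<integral>\<^sup>+y. ennreal (?c n) * indicator (ball x (\<delta> / 2 ^ n)) y \<partial>lebesgue)"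
    by (intro nn_integral_suminf borel_measurable_times_ennreal borel_measurable_const
        borel_measurable_indicator) simp
  also have "\<dots> = (\<Sum>n. ennreal (2 powr \<alpha> * ?V * \<delta> powr (?d - \<alpha>) * (2 powr (\<alpha> - ?d)) ^ n))"
  proof (intro suminf_cong)
    fix n
    have "(\<integral>\<^sup>+y. ennreal (?c n) * indicator (ball x (\<delta> / 2 ^ n)) y \<partial>lebesgue) =
        ennreal (?c n) * emeasure lborel (ball x (\<delta> / 2 ^ n))"
      by (subst nn_integral_cmult_indicator) (auto simp: emeasure_completion)
    also have "\<dots> = ennreal (?c n * (?V * (\<delta> / 2 ^ n) ^ DIM('a)))"
      using \<delta> by (subst emeasure_ball) (auto simp: ennreal_mult'')
    also have "?c n * (?V * (\<delta> / 2 ^ n) ^ DIM('a)) =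
        2 powr \<alpha> * ?V * \<delta> powr (?d - \<alpha>) * (2 powr (\<alpha> - ?d)) ^ n"
    proof -
      have "(2::real) ^ Suc n = 2 powr (1 + real n)" and two: "(2::real) ^ n = 2 powr real n"
        by (simp_all add: powr_realpow powr_add)
      then have "?c n = \<delta> powr (- \<alpha>) / 2 powr ((1 + real n) * (- \<alpha>))"
        using \<delta> by (simp only: powr_divide powr_powr)
      also have "\<dots> = \<delta> powr (- \<alpha>) * (2 powr \<alpha> * 2 powr (\<alpha> * n))"
        unfolding powr_add[symmetric] divide_powr_uminus by (simp add: algebra_simps)
      finally have "?c n = \<delta> powr (- \<alpha>) * (2 powr \<alpha> * 2 powr (\<alpha> * n))" .
      moreover have "(\<delta> / 2 ^ n) ^ DIM('a) = \<delta> powr ?d * 2 powr (- (?d * n))"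
      proof -
        have "(\<delta> / 2 ^ n) ^ DIM('a) = (\<delta> / 2 powr n) powr ?d"
          using \<delta> by (subst powr_realpow) (simp_all add: two)
        also have "\<dots> = \<delta> powr ?d / 2 powr (n * ?d)"
          using \<delta> by (simp only: powr_divide powr_powr)
        finally show ?thesis
          by (simp only: divide_powr_uminus mult.commute)
      qed
      moreover have "(2 powr (\<alpha> - ?d)) ^ n = 2 powr (\<alpha> * n) * 2 powr (- (?d * n))"
      proof -
        have "(2 powr (\<alpha> - ?d)) ^ n = (2 powr (\<alpha> - ?d)) powr n"
          by (subst powr_realpow) simp_all
        also have "\<dots> = 2 powr (\<alpha> * n + - (?d * n))"
          unfolding powr_powr by (simp add: left_diff_distrib)
        finally show ?thesis
          by (simp only: powr_add)
      qed
      moreover have "\<delta> powr (?d - \<alpha>) = \<delta> powr (- \<alpha>) * \<delta> powr ?d"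
        unfolding powr_add[symmetric] by simp
      ultimately show ?thesis
        by simp
    qed
    finally show "(\<integral>\<^sup>+y. ennreal (?c n) * indicator (ball x (\<delta> / 2 ^ n)) y \<partial>lebesgue) =
        ennreal (2 powr \<alpha> * ?V * \<delta> powr (?d - \<alpha>) * (2 powr (\<alpha> - ?d)) ^ n)" .
  qed
  also have "\<dots> = ennreal (riesz_constant TYPE('a) \<alpha> * \<delta> powr (?d - \<alpha>))"
  proof (intro suminf_ennreal_eq)
    have "(\<lambda>n. (2 powr \<alpha> * ?V * \<delta> powr (?d - \<alpha>)) * (2 powr (\<alpha> - ?d)) ^ n) sums
        ((2 powr \<alpha> * ?V * \<delta> powr (?d - \<alpha>)) * (1 / (1 - 2 powr (\<alpha> - ?d))))"
      using q by (intro sums_mult geometric_sums) auto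
    then show "(\<lambda>n. 2 powr \<alpha> * ?V * \<delta> powr (?d - \<alpha>) * (2 powr (\<alpha> - ?d)) ^ n) sums
        (riesz_constant TYPE('a) \<alpha> * \<delta> powr (?d - \<alpha>))"
      by (simp add: riesz_constant_def mult_ac)
  qed simp
  finally show ?thesis .
qed

lemma riesz_constant_nonneg:
  fixes \<alpha> :: real
  assumes "\<alpha> < DIM('a)"
  shows "0 \<le> riesz_constant TYPE('a::euclidean_space) \<alpha>"
proof -
  have "2 powr (\<alpha> - DIM('a)) < (1::real)"
    using assms by (simp add: powr_less_one)
  then show ?thesis
    by (simp add: riesz_constant_def)
qed

locale weakly_singular_kernel =
  fixes \<Omega> :: "'a::euclidean_space set" and G :: "'a \<Rightarrow> 'a \<Rightarrow> real" and A \<alpha> :: real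
  assumes open_\<Omega>: "open \<Omega>" and bounded_\<Omega>: "bounded \<Omega>"
    and A_nonneg: "0 \<le> A" and \<alpha>: "0 \<le> \<alpha>" "\<alpha> < DIM('a)"
    and continuous_off_diagonal:
      "continuous_on {(x, y). x \<in> closure \<Omega> \<and> y \<in> \<Omega> \<and> x \<noteq> y} (\<lambda>(x, y). G x y)"
    and kernel_bound:
      "\<And>x y. x \<in> closure \<Omega> \<Longrightarrow> y \<in> \<Omega> \<Longrightarrow> x \<noteq> y \<Longrightarrow> \<bar>G x y\<bar> \<le> A * dist x y powr (- \<alpha>)"
begin

lemma sets_\<Omega> [measurable, simp]: "\<Omega> \<in> sets lebesgue"
  using open_\<Omega> by auto

lemma emeasure_\<Omega>_finite: "emeasure lebesgue \<Omega> < \<infinity>"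
  using bounded_\<Omega> sets_\<Omega> by (metis bounded_set_imp_lmeasurable fmeasurableD2 infinity_ennreal_def top.not_eq_extremum)

text \<open>The values \<open>G x x\<close> are arbitrary; all estimates hold off the diagonal and ignore this null set.\<close>

lemma AE_neq: "AE y in lebesgue_on \<Omega>. y \<noteq> x"
proof -
  have "AE y in lebesgue. y \<noteq> x"
    by (rule AE_I'[of "{x}"]) (auto simp: negligible_iff_null_sets[symmetric])
  then show ?thesis
    by (subst AE_restrict_space_iff) auto
qed

lemma kernel_measurable:
  assumes x: "x \<in> closure \<Omega>"
  shows "G x \<in> borel_measurable (lebesgue_on \<Omega>)"
proof -
  have "continuous_on (\<Omega> - {x}) (G x)"
    using x by (intro continuous_on_compose2[OF continuous_off_diagonal, of _ "\<lambda>y. (x, y)", simplified])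
      (auto intro!: continuous_intros)
  then have "G x \<in> borel_measurable (lebesgue_on (\<Omega> - {x}))"
    by (intro continuous_imp_measurable_on_sets_lebesgue) (auto simp: open_\<Omega>)
  then have "(\<lambda>y. if y \<in> \<Omega> - {x} then G x y else 0) \<in> borel_measurable lebesgue"
    by (subst borel_measurable_if) (auto simp: open_\<Omega>)
  moreover have "(\<lambda>y. if y \<in> {x} then G x x else 0) \<in> borel_measurable lebesgue"
    by (intro measurable_If_set) auto
  ultimately have "(\<lambda>y. (if y \<in> \<Omega> - {x} then G x y else 0) + (if y \<in> {x} then G x x else 0))
      \<in> borel_measurable (lebesgue_on \<Omega>)"
    by (intro measurable_restrict_space1 borel_measurable_add)
  then show ?thesis
    by (rule measurable_cong[THEN iffD1, rotated]) auto
qed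

lemma nn_integral_kernel_ball_le:
  assumes x: "x \<in> closure \<Omega>" and \<delta>: "0 < \<delta>"
  shows "(\<integral>\<^sup>+y. ennreal \<bar>G x y\<bar> * indicator (ball x \<delta>) y \<partial>lebesgue_on \<Omega>)
    \<le> ennreal (A * (riesz_constant TYPE('a) \<alpha> * \<delta> powr (DIM('a) - \<alpha>)))"
proof -
  have "(\<integral>\<^sup>+y. ennreal \<bar>G x y\<bar> * indicator (ball x \<delta>) y \<partial>lebesgue_on \<Omega>) \<le>
      (\<integral>\<^sup>+y. ennreal A * (ennreal (dist x y powr (- \<alpha>)) * indicator (ball x \<delta>) y) \<partial>lebesgue_on \<Omega>)"
  proof (rule nn_integral_mono_AE)
    have "AE y in lebesgue_on \<Omega>. y \<in> \<Omega>"
      by (rule AE_I2) auto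
    then show "AE y in lebesgue_on \<Omega>. ennreal \<bar>G x y\<bar> * indicator (ball x \<delta>) y
        \<le> ennreal A * (ennreal (dist x y powr (- \<alpha>)) * indicator (ball x \<delta>) y)"
      using AE_neq[of x]
    proof eventually_elim
      case (elim y)
      then show ?case
        using kernel_bound[OF x, of y] A_nonneg
        unfolding ennreal_mult'[OF A_nonneg, symmetric] mult.assoc[symmetric]
        by (intro mult_right_mono ennreal_leI) auto
    qed
  qed
  also have "\<dots> \<le> (\<integral>\<^sup>+y. ennreal A * (ennreal (dist x y powr (- \<alpha>)) * indicator (ball x \<delta>) y) \<partial>lebesgue)"
    by (subst nn_integral_restrict_space)
      (auto intro!: nn_integral_mono split: split_indicator)
  also have "\<dots> = ennreal A * (\<integral>\<^sup>+y. ennreal (dist x y powr (- \<alpha>)) * indicator (ball x \<delta>) y \<partial>lebesgue)"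
    by (intro nn_integral_cmult measurable_completion borel_measurable_times_ennreal
        borel_measurable_indicator) auto
  also have "\<dots> \<le> ennreal A * ennreal (riesz_constant TYPE('a) \<alpha> * \<delta> powr (DIM('a) - \<alpha>))"
    by (intro mult_left_mono nn_integral_dist_powr_ball_le \<alpha> \<delta>) auto
  also have "\<dots> = ennreal (A * (riesz_constant TYPE('a) \<alpha> * \<delta> powr (DIM('a) - \<alpha>)))"
    by (rule ennreal_mult'[OF A_nonneg, symmetric])
  finally show ?thesis .
qed

lemma kernel_integral_uniform_bound:
  obtains B where "\<And>x. x \<in> closure \<Omega> \<Longrightarrow> integrable (lebesgue_on \<Omega>) (G x)"
    and "\<And>x. x \<in> closure \<Omega> \<Longrightarrow> (LINT y|lebesgue_on \<Omega>. \<bar>G x y\<bar>) \<le> B"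
proof -
  obtain R where R: "0 < R" "\<And>x y. x \<in> closure \<Omega> \<Longrightarrow> y \<in> \<Omega> \<Longrightarrow> dist x y < R"
  proof -
    have "bounded (closure \<Omega>)"
      using bounded_\<Omega> by (rule bounded_closure)
    then obtain R where R: "\<forall>x\<in>closure \<Omega>. \<forall>y\<in>closure \<Omega>. dist x y \<le> R"
      unfolding bounded_two_points by blast
    show ?thesis
    proof (rule that)
      show "0 < \<bar>R\<bar> + 1"
        by simp
      show "dist x y < \<bar>R\<bar> + 1" if "x \<in> closure \<Omega>" "y \<in> \<Omega>" for x y
        using R that(1) subsetD[OF closure_subset that(2)] by fastforce
    qed
  qed
  define B where "B = A * (riesz_constant TYPE('a) \<alpha> * R powr (DIM('a) - \<alpha>))"
  have B: "0 \<le> B"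
    using A_nonneg riesz_constant_nonneg[OF \<alpha>(2)] by (simp add: B_def)
  have nn: "(\<integral>\<^sup>+y. ennreal \<bar>G x y\<bar> \<partial>lebesgue_on \<Omega>) \<le> ennreal B" if x: "x \<in> closure \<Omega>" for x
  proof -
    have "(\<integral>\<^sup>+y. ennreal \<bar>G x y\<bar> \<partial>lebesgue_on \<Omega>) =
        (\<integral>\<^sup>+y. ennreal \<bar>G x y\<bar> * indicator (ball x R) y \<partial>lebesgue_on \<Omega>)"
      using R(2)[OF x] by (intro nn_integral_cong) auto
    then show ?thesis
      using nn_integral_kernel_ball_le[OF x R(1)] by (simp add: B_def)
  qed
  show ?thesis
  proof (rule that)
    show int: "integrable (lebesgue_on \<Omega>) (G x)" if x: "x \<in> closure \<Omega>" for x
      using nn[OF x] kernel_measurable[OF x]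
      by (intro integrableI_bounded) (auto intro: le_less_trans)
    show "(LINT y|lebesgue_on \<Omega>. \<bar>G x y\<bar>) \<le> B" if x: "x \<in> closure \<Omega>" for x
    proof -
      have "ennreal (LINT y|lebesgue_on \<Omega>. \<bar>G x y\<bar>) = (\<integral>\<^sup>+y. ennreal \<bar>G x y\<bar> \<partial>lebesgue_on \<Omega>)"
        using int[OF x] by (intro nn_integral_eq_integral[symmetric]) auto
      then show ?thesis
        using nn[OF x] unfolding ennreal_le_iff[OF B, symmetric] by (rule ord_eq_le_trans)
    qed
  qed
qed

lemma kernel_integrable: "x \<in> closure \<Omega> \<Longrightarrow> integrable (lebesgue_on \<Omega>) (G x)"
  by (rule kernel_integral_uniform_bound) fast

lemma kernel_mult_integrable:
  assumes x: "x \<in> closure \<Omega>" and w: "w \<in> borel_measurable (lebesgue_on \<Omega>)"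
    and bd: "AE y in lebesgue_on \<Omega>. \<bar>w y\<bar> \<le> M"
  shows "integrable (lebesgue_on \<Omega>) (\<lambda>y. G x y * w y)"
proof (rule Bochner_Integration.integrable_bound)
  show "integrable (lebesgue_on \<Omega>) (\<lambda>y. M * G x y)"
    using kernel_integrable[OF x] by simp
  show "(\<lambda>y. G x y * w y) \<in> borel_measurable (lebesgue_on \<Omega>)"
    using kernel_measurable[OF x] w by simp
  show "AE y in lebesgue_on \<Omega>. norm (G x y * w y) \<le> norm (M * G x y)"
    using bd
  proof eventually_elim
    case (elim y)
    then have "\<bar>w y\<bar> \<le> \<bar>M\<bar>"
      by linarith
    then show ?case
      by (auto simp: abs_mult mult.commute[of "\<bar>G x y\<bar>"] intro: mult_right_mono)
  qed
qed

text \<open>Near the limit point the contributions are uniformly small by the weak singularity; away from it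
  the kernel is bounded and dominated convergence applies.\<close>

lemma kernel_integral_tendsto:
  assumes xs: "\<And>n. xs n \<in> closure \<Omega>" "xs \<longlonglongrightarrow> x" and x: "x \<in> closure \<Omega>"
    and w: "\<And>n. w n \<in> borel_measurable (lebesgue_on \<Omega>)" "w' \<in> borel_measurable (lebesgue_on \<Omega>)"
    and bd: "\<And>n. AE y in lebesgue_on \<Omega>. \<bar>w n y\<bar> \<le> M" "AE y in lebesgue_on \<Omega>. \<bar>w' y\<bar> \<le> M"
    and lim: "\<And>y. y \<in> \<Omega> \<Longrightarrow> (\<lambda>n. w n y) \<longlonglongrightarrow> w' y"
    and M: "0 \<le> M"
  shows "(\<lambda>n. LINT y|lebesgue_on \<Omega>. G (xs n) y * w n y) \<longlonglongrightarrow> (LINT y|lebesgue_on \<Omega>. G x y * w' y)"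
proof (rule LIMSEQ_I)
  fix e :: real assume e: "0 < e"
  let ?c = "M * (A * riesz_constant TYPE('a) \<alpha>)"
  let ?p = "DIM('a) - \<alpha>"
  have c: "0 \<le> ?c"
    using M A_nonneg riesz_constant_nonneg[OF \<alpha>(2)] by simp
  obtain \<delta> where \<delta>: "0 < \<delta>" "?c * (2 * \<delta>) powr ?p < e / 4"
  proof -
    have "((\<lambda>\<delta>. ?c * (2 * \<delta>) powr ?p) \<longlongrightarrow> ?c * (2 * 0) powr ?p) (at_right 0)"
      using \<alpha> by (intro tendsto_intros tendsto_powr') (auto simp: eventually_at_right_less
          intro!: eventually_at_rightI[of 0 1])
    then have "\<forall>\<^sub>F \<delta> in at_right 0. ?c * (2 * \<delta>) powr ?p < e / 4"
      using e by (intro order_tendstoD(2)) auto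
    then have "\<forall>\<^sub>F \<delta> in at_right 0. ?c * (2 * \<delta>) powr ?p < e / 4 \<and> \<delta> > 0"
      by (intro eventually_conj eventually_at_right_less)
    then obtain \<delta> where "?c * (2 * \<delta>) powr ?p < e / 4 \<and> \<delta> > 0"
      using eventually_happens trivial_limit_at_right_real by blast
    then show ?thesis
      using that by blast
  qed
  let ?N = "ball x \<delta>"
  have ind: "(\<lambda>y. indicator ?N y :: real) \<in> borel_measurable (lebesgue_on \<Omega>)"
    by (intro measurable_restrict_space1 borel_measurable_indicator) auto
  have int: "integrable (lebesgue_on \<Omega>) (\<lambda>y. G z y * (v y * indicator ?N y))"
    "integrable (lebesgue_on \<Omega>) (\<lambda>y. G z y * (v y * (1 - indicator ?N y)))"
    if z: "z \<in> closure \<Omega>" and v: "v \<in> borel_measurable (lebesgue_on \<Omega>)"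
      "AE y in lebesgue_on \<Omega>. \<bar>v y\<bar> \<le> M" for z v
  proof -
    have "AE y in lebesgue_on \<Omega>. \<bar>v y * indicator ?N y\<bar> \<le> M"
      using v(2) by eventually_elim (use M in \<open>simp add: indicator_def\<close>)
    then show "integrable (lebesgue_on \<Omega>) (\<lambda>y. G z y * (v y * indicator ?N y))"
      by (intro kernel_mult_integrable[OF z] borel_measurable_times v(1) ind)
    have "AE y in lebesgue_on \<Omega>. \<bar>v y * (1 - indicator ?N y)\<bar> \<le> M"
      using v(2) by eventually_elim (use M in \<open>simp add: indicator_def\<close>)
    then show "integrable (lebesgue_on \<Omega>) (\<lambda>y. G z y * (v y * (1 - indicator ?N y)))"
      by (intro kernel_mult_integrable[OF z] borel_measurable_times borel_measurable_diff
          borel_measurable_const v(1) ind)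
  qed
  have near: "\<bar>LINT y|lebesgue_on \<Omega>. G z y * v y * indicator ?N y\<bar> < e / 4"
    if z: "z \<in> closure \<Omega>" "dist z x < \<delta>" and v: "v \<in> borel_measurable (lebesgue_on \<Omega>)"
      "AE y in lebesgue_on \<Omega>. \<bar>v y\<bar> \<le> M" for z v
  proof -
    have "ennreal \<bar>LINT y|lebesgue_on \<Omega>. G z y * v y * indicator ?N y\<bar> \<le>
        (\<integral>\<^sup>+y. ennreal (norm (G z y * v y * indicator ?N y)) \<partial>lebesgue_on \<Omega>)"
      using integral_norm_bound_ennreal[OF int(1)[OF z(1) v]]
      unfolding real_norm_def mult.assoc .
    also have "\<dots> \<le> (\<integral>\<^sup>+y. ennreal M * (ennreal \<bar>G z y\<bar> * indicator (ball z (2 * \<delta>)) y) \<partial>lebesgue_on \<Omega>)"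
      using v(2)
    proof (intro nn_integral_mono_AE, eventually_elim)
      case (elim y)
      have "y \<in> ?N \<Longrightarrow> y \<in> ball z (2 * \<delta>)"
        using z(2) dist_triangle[of z y x] by auto
      then show ?case
        using elim M by (auto simp: indicator_def abs_mult ennreal_mult'[symmetric]
            mult.commute[of M] intro!: ennreal_leI mult_left_mono)
    qed
    also have "\<dots> = ennreal M * (\<integral>\<^sup>+y. ennreal \<bar>G z y\<bar> * indicator (ball z (2 * \<delta>)) y \<partial>lebesgue_on \<Omega>)"
      using kernel_measurable[OF z(1)]
      by (intro nn_integral_cmult borel_measurable_times_ennreal measurable_compose[OF _ measurable_ennreal] borel_measurable_abs
          measurable_restrict_space1[OF borel_measurable_indicator]) auto
    also have "\<dots> \<le> ennreal M * ennreal (A * (riesz_constant TYPE('a) \<alpha> * (2 * \<delta>) powr ?p))"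
      using \<delta> by (intro mult_left_mono nn_integral_kernel_ball_le z) auto
    also have "\<dots> = ennreal (?c * (2 * \<delta>) powr ?p)"
      using M by (simp add: ennreal_mult'[symmetric] mult_ac)
    also have "\<dots> < ennreal (e / 4)"
      using \<delta> c by (intro ennreal_lessI) (use e in auto)
    finally show ?thesis
      using e by (simp add: ennreal_less_iff)
  qed
  have meas: "(\<lambda>y. G z y * v y * (1 - indicator ?N y)) \<in> borel_measurable (lebesgue_on \<Omega>)"
    if "z \<in> closure \<Omega>" "v \<in> borel_measurable (lebesgue_on \<Omega>)" for z v
    using kernel_measurable[OF that(1)] that(2) ind by simp
  have split: "(LINT y|lebesgue_on \<Omega>. G z y * v y) =
      (LINT y|lebesgue_on \<Omega>. G z y * v y * indicator ?N y) +
      (LINT y|lebesgue_on \<Omega>. G z y * v y * (1 - indicator ?N y))"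
    if "z \<in> closure \<Omega>" "v \<in> borel_measurable (lebesgue_on \<Omega>)"
      "AE y in lebesgue_on \<Omega>. \<bar>v y\<bar> \<le> M" for z v
    using int[OF that] by (subst Bochner_Integration.integral_add[symmetric]) (auto simp: algebra_simps)
  obtain n0 where n0: "\<And>n. n \<ge> n0 \<Longrightarrow> dist (xs n) x < \<delta> / 2"
    using xs(2) \<delta>(1) by (metis half_gt_zero metric_LIMSEQ_D)
  have far: "(\<lambda>n. LINT y|lebesgue_on \<Omega>. G (xs (n + n0)) y * w (n + n0) y * (1 - indicator ?N y))
      \<longlonglongrightarrow> (LINT y|lebesgue_on \<Omega>. G x y * w' y * (1 - indicator ?N y))"
  proof (rule integral_dominated_convergence[where w = "\<lambda>_. A * (\<delta> / 2) powr (- \<alpha>) * M"])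
    show "integrable (lebesgue_on \<Omega>) (\<lambda>_. A * (\<delta> / 2) powr (- \<alpha>) * M)"
      using emeasure_\<Omega>_finite by (intro finite_measure.integrable_const finite_measureI)
        (auto simp: emeasure_restrict_space space_restrict_space)
    show "AE y in lebesgue_on \<Omega>.
        (\<lambda>n. G (xs (n + n0)) y * w (n + n0) y * (1 - indicator ?N y))
        \<longlonglongrightarrow> G x y * w' y * (1 - indicator ?N y)"
    proof (rule AE_I2)
      fix y assume "y \<in> space (lebesgue_on \<Omega>)"
      then have y: "y \<in> \<Omega>" by simp
      show "(\<lambda>n. G (xs (n + n0)) y * w (n + n0) y * (1 - indicator ?N y))
        \<longlonglongrightarrow> G x y * w' y * (1 - indicator ?N y)"
      proof (cases "y \<in> ?N")
        case False
        have neq: "xs (n + n0) \<noteq> y" for n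
          using n0[of "n + n0"] False \<delta> by (auto simp: dist_commute)
        have "(\<lambda>n. (xs (n + n0), y)) \<longlonglongrightarrow> (x, y)"
          using LIMSEQ_ignore_initial_segment[OF xs(2)] by (intro tendsto_intros)
        then have "(\<lambda>n. (\<lambda>(x, y). G x y) (xs (n + n0), y)) \<longlonglongrightarrow> (\<lambda>(x, y). G x y) (x, y)"
          using x y xs(1) neq False \<delta>
          by (intro continuous_on_tendsto_compose[OF continuous_off_diagonal]) auto
        then show ?thesis
          using LIMSEQ_ignore_initial_segment[OF lim[OF y]] by (intro tendsto_intros) auto
      qed simp
    qed
    fix n
    show "AE y in lebesgue_on \<Omega>. norm (G (xs (n + n0)) y * w (n + n0) y * (1 - indicator ?N y))
        \<le> A * (\<delta> / 2) powr (- \<alpha>) * M"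
    proof -
      have "AE y in lebesgue_on \<Omega>. y \<in> \<Omega>"
        by (rule AE_I2) auto
      then show ?thesis
        using bd(1)[of "n + n0"]
      proof eventually_elim
        case (elim y)
        show ?case
        proof (cases "y \<in> ?N")
          case False
          have d: "\<delta> / 2 \<le> dist (xs (n + n0)) y"
            using n0[of "n + n0"] False dist_triangle[of x y "xs (n + n0)"]
            by (auto simp: dist_commute)
          then have "\<bar>G (xs (n + n0)) y\<bar> \<le> A * dist (xs (n + n0)) y powr (- \<alpha>)"
            using elim xs(1) \<delta> by (intro kernel_bound) auto
          also have "\<dots> \<le> A * (\<delta> / 2) powr (- \<alpha>)"
            using d \<delta> \<alpha> A_nonneg by (intro mult_left_mono powr_mono2') auto
          finally show ?thesis
            using elim False M A_nonneg by (auto simp: abs_mult intro!: mult_mono)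
        qed (use A_nonneg M in auto)
      qed
    qed
  qed (intro meas x xs w)+
  from LIMSEQ_D[OF far, of "e / 4"] e obtain n1 where n1:
    "\<And>n. n \<ge> n1 \<Longrightarrow>
      \<bar>(LINT y|lebesgue_on \<Omega>. G (xs (n + n0)) y * w (n + n0) y * (1 - indicator ?N y)) -
       (LINT y|lebesgue_on \<Omega>. G x y * w' y * (1 - indicator ?N y))\<bar> < e / 4"
    by auto
  show "\<exists>no. \<forall>n\<ge>no.
      norm ((LINT y|lebesgue_on \<Omega>. G (xs n) y * w n y) - (LINT y|lebesgue_on \<Omega>. G x y * w' y)) < e"
  proof (intro exI[of _ "n0 + n1"] allI impI)
    fix n assume n: "n0 + n1 \<le> n"
    have "dist (xs n) x < \<delta>"
      using n0[of n] n \<delta> by simp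
    note near_n = near[OF xs(1) this w(1) bd(1)]
    have "dist x x < \<delta>"
      using \<delta> by simp
    note near_x = near[OF x this w(2) bd(2)]
    have "n1 \<le> n - n0" "n - n0 + n0 = n"
      using n by simp_all
    note far_n = n1[OF this(1), unfolded this(2)]
    have *: "\<bar>(a + b) - (c + d)\<bar> < e" if "\<bar>a\<bar> < e / 4" "\<bar>c\<bar> < e / 4" "\<bar>b - d\<bar> < e / 4" for a b c d
      using that e by linarith
    show "norm ((LINT y|lebesgue_on \<Omega>. G (xs n) y * w n y) - (LINT y|lebesgue_on \<Omega>. G x y * w' y)) < e"
      unfolding split[OF xs(1) w(1) bd(1), of n n] split[OF x w(2) bd(2)] real_norm_def
      by (rule *[OF near_n near_x far_n])
  qed
qed

lemma abs_kernel: "weakly_singular_kernel \<Omega> (\<lambda>x y. \<bar>G x y\<bar>) A \<alpha>"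
proof
  show "continuous_on {(x, y). x \<in> closure \<Omega> \<and> y \<in> \<Omega> \<and> x \<noteq> y} (\<lambda>(x, y). \<bar>G x y\<bar>)"
    using continuous_on_rabs[OF continuous_off_diagonal] by (simp add: case_prod_unfold)
qed (use open_\<Omega> bounded_\<Omega> A_nonneg \<alpha> kernel_bound in auto)

text \<open>The supremum over \<open>\<Omega>\<close> also controls boundary points, which is where the forward operators are
  finally evaluated.\<close>

lemma kernel_integral_le_SUP:
  assumes x: "x \<in> closure \<Omega>"
  shows "(LINT y|lebesgue_on \<Omega>. \<bar>G x y\<bar>) \<le> (SUP x\<in>\<Omega>. LINT y|lebesgue_on \<Omega>. \<bar>G x y\<bar>)"
proof (rule continuous_le_on_closure[OF _ x])
  interpret abs: weakly_singular_kernel \<Omega> "\<lambda>x y. \<bar>G x y\<bar>" A \<alpha>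
    by (rule abs_kernel)
  show "continuous_on (closure \<Omega>) (\<lambda>x. LINT y|lebesgue_on \<Omega>. \<bar>G x y\<bar>)"
    unfolding continuous_on_sequentially
    using abs.kernel_integral_tendsto[where M = 1 and w = "\<lambda>_ _. 1" and w' = "\<lambda>_. 1"]
    by (auto simp: o_def)
  obtain B where B: "\<And>x. x \<in> closure \<Omega> \<Longrightarrow> (LINT y|lebesgue_on \<Omega>. \<bar>G x y\<bar>) \<le> B"
    using kernel_integral_uniform_bound by blast
  show "(LINT y|lebesgue_on \<Omega>. \<bar>G z y\<bar>) \<le> (SUP x\<in>\<Omega>. LINT y|lebesgue_on \<Omega>. \<bar>G x y\<bar>)"
    if "z \<in> \<Omega>" for z
    using that B closure_subset[of \<Omega>]
    by (intro cSUP_upper bdd_aboveI2[where M = B]) auto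
qed

end

section \<open>Suprema of continuous functions and the norm of \<open>[L\<^sup>\<infinity>(\<Omega>)]\<^bsup>L-1\<^esup>\<close>\<close>

lemma abs_le_C_norm:
  assumes "compact S" "continuous_on S f" "p \<in> S"
  shows "\<bar>f p\<bar> \<le> C_norm S f"
proof -
  have "compact ((\<lambda>p. \<bar>f p\<bar>) ` S)"
    using assms by (intro compact_continuous_image continuous_intros)
  then have "bdd_above ((\<lambda>p. \<bar>f p\<bar>) ` S)"
    by (intro bounded_imp_bdd_above compact_imp_bounded)
  then show ?thesis
    unfolding C_norm_def using assms(3) by (intro cSUP_upper)
qed

lemma C_norm_le: "S \<noteq> {} \<Longrightarrow> (\<And>p. p \<in> S \<Longrightarrow> \<bar>f p\<bar> \<le> c) \<Longrightarrow> C_norm S f \<le> c"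
  unfolding C_norm_def by (intro cSUP_least)

locale Linf_space =
  fixes \<Omega> :: "'a::euclidean_space set" and L :: nat
  assumes open_dom: "open \<Omega>" and nonempty_dom: "\<Omega> \<noteq> {}" and L_ge_2: "2 \<le> L"
begin

lemma esssup_abs_nonneg:
  assumes "f \<in> borel_measurable (lebesgue_on \<Omega>)"
  shows "0 \<le> esssup (lebesgue_on \<Omega>) (\<lambda>x. ereal \<bar>f x\<bar>)"
proof -
  have \<Omega>: "\<Omega> \<in> sets lebesgue"
    using open_dom by auto
  have "\<not> negligible \<Omega>"
    using open_dom nonempty_dom by (rule open_not_negligible)
  then have "emeasure (lebesgue_on \<Omega>) (space (lebesgue_on \<Omega>)) \<noteq> 0"
    using \<Omega> by (auto simp: negligible_iff_null_sets null_sets_def emeasure_restrict_space)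
  then have "0 = esssup (lebesgue_on \<Omega>) (\<lambda>x. 0 :: ereal)"
    by (rule esssup_const[symmetric])
  also have "\<dots> \<le> esssup (lebesgue_on \<Omega>) (\<lambda>x. ereal \<bar>f x\<bar>)"
    by (rule esssup_mono) auto
  finally show ?thesis .
qed

lemma Linf_measurable: "\<beta> \<in> Linf \<Omega> L \<Longrightarrow> l \<in> {2..L} \<Longrightarrow> \<beta> l \<in> borel_measurable (lebesgue_on \<Omega>)"
  by (simp add: Linf_def)

text \<open>Together with \<open>AE_abs_le_Linf_norm\<close> this characterizes the norm by almost-everywhere bounds;
  later arguments never unfold the essential supremum.\<close>

lemma Linf_boundedI:
  assumes m: "\<And>l. l \<in> {2..L} \<Longrightarrow> \<beta> l \<in> borel_measurable (lebesgue_on \<Omega>)"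
    and b: "\<And>l. l \<in> {2..L} \<Longrightarrow> AE x in lebesgue_on \<Omega>. \<bar>\<beta> l x\<bar> \<le> c"
  shows "\<beta> \<in> Linf \<Omega> L" and "Linf_norm \<Omega> L \<beta> \<le> c"
proof -
  have le: "esssup (lebesgue_on \<Omega>) (\<lambda>x. ereal \<bar>\<beta> l x\<bar>) \<le> ereal c" if l: "l \<in> {2..L}" for l
    using m[OF l] b[OF l] by (intro esssup_I) auto
  have "esssup (lebesgue_on \<Omega>) (\<lambda>x. ereal \<bar>\<beta> l x\<bar>) < \<infinity>" if "l \<in> {2..L}" for l
    using le[OF that] by (rule order.strict_trans1) simp
  then show "\<beta> \<in> Linf \<Omega> L"
    using m by (auto simp: Linf_def)
  have "real_of_ereal (esssup (lebesgue_on \<Omega>) (\<lambda>x. ereal \<bar>\<beta> l x\<bar>)) \<le> c" if l: "l \<in> {2..L}" for l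
    using le[OF l] esssup_abs_nonneg[OF m[OF l]]
    by (cases "esssup (lebesgue_on \<Omega>) (\<lambda>x. ereal \<bar>\<beta> l x\<bar>)") auto
  then show "Linf_norm \<Omega> L \<beta> \<le> c"
    unfolding Linf_norm_def using L_ge_2 by (intro Max.boundedI) auto
qed

lemma real_esssup_le_Linf_norm:
  assumes "l \<in> {2..L}"
  shows "real_of_ereal (esssup (lebesgue_on \<Omega>) (\<lambda>x. ereal \<bar>\<beta> l x\<bar>)) \<le> Linf_norm \<Omega> L \<beta>"
  unfolding Linf_norm_def using assms by (intro Max_ge) auto

lemma AE_abs_le_Linf_norm:
  assumes \<beta>: "\<beta> \<in> Linf \<Omega> L" and l: "l \<in> {2..L}"
  shows "AE x in lebesgue_on \<Omega>. \<bar>\<beta> l x\<bar> \<le> Linf_norm \<Omega> L \<beta>"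
proof -
  let ?e = "esssup (lebesgue_on \<Omega>) (\<lambda>x. ereal \<bar>\<beta> l x\<bar>)"
  have "?e < \<infinity>" "0 \<le> ?e"
    using \<beta> l esssup_abs_nonneg[OF Linf_measurable[OF \<beta> l]] by (auto simp: Linf_def)
  then obtain e where e: "?e = ereal e"
    by (cases ?e) auto
  have "e \<le> Linf_norm \<Omega> L \<beta>"
    using real_esssup_le_Linf_norm[OF l, of \<beta>] by (simp add: e)
  moreover have "AE x in lebesgue_on \<Omega>. ereal \<bar>\<beta> l x\<bar> \<le> ?e"
    by (rule esssup_AE)
  ultimately show ?thesis
    unfolding e by (auto elim!: eventually_mono)
qed

lemma Linf_norm_nonneg:
  assumes "\<beta> \<in> Linf \<Omega> L"
  shows "0 \<le> Linf_norm \<Omega> L \<beta>"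
proof -
  have "0 \<le> esssup (lebesgue_on \<Omega>) (\<lambda>x. ereal \<bar>\<beta> 2 x\<bar>)"
    using Linf_measurable[OF assms, of 2] L_ge_2 by (intro esssup_abs_nonneg) auto
  then have "0 \<le> real_of_ereal (esssup (lebesgue_on \<Omega>) (\<lambda>x. ereal \<bar>\<beta> 2 x\<bar>))"
    by (rule real_of_ereal_pos)
  also have "\<dots> \<le> Linf_norm \<Omega> L \<beta>"
    using L_ge_2 by (intro real_esssup_le_Linf_norm) auto
  finally show ?thesis .
qed

lemma Linf_sum:
  assumes "finite I" and f: "\<And>i. i \<in> I \<Longrightarrow> f i \<in> Linf \<Omega> L"
  shows "(\<lambda>l x. \<Sum>i\<in>I. f i l x) \<in> Linf \<Omega> L"
    and "Linf_norm \<Omega> L (\<lambda>l x. \<Sum>i\<in>I. f i l x) \<le> (\<Sum>i\<in>I. Linf_norm \<Omega> L (f i))"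
proof -
  have m: "(\<lambda>x. \<Sum>i\<in>I. f i l x) \<in> borel_measurable (lebesgue_on \<Omega>)" if "l \<in> {2..L}" for l
    using Linf_measurable[OF f that] by (intro borel_measurable_sum)
  have b: "AE x in lebesgue_on \<Omega>. \<bar>\<Sum>i\<in>I. f i l x\<bar> \<le> (\<Sum>i\<in>I. Linf_norm \<Omega> L (f i))"
    if l: "l \<in> {2..L}" for l
  proof -
    have "AE x in lebesgue_on \<Omega>. \<forall>i\<in>I. \<bar>f i l x\<bar> \<le> Linf_norm \<Omega> L (f i)"
      using AE_abs_le_Linf_norm[OF f l] by (intro AE_finite_allI assms(1))
    then show ?thesis
    proof eventually_elim
      case (elim x)
      have "\<bar>\<Sum>i\<in>I. f i l x\<bar> \<le> (\<Sum>i\<in>I. \<bar>f i l x\<bar>)"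
        by (rule sum_abs)
      also have "\<dots> \<le> (\<Sum>i\<in>I. Linf_norm \<Omega> L (f i))"
        using elim by (intro sum_mono) auto
      finally show ?case .
    qed
  qed
  show "(\<lambda>l x. \<Sum>i\<in>I. f i l x) \<in> Linf \<Omega> L"
    "Linf_norm \<Omega> L (\<lambda>l x. \<Sum>i\<in>I. f i l x) \<le> (\<Sum>i\<in>I. Linf_norm \<Omega> L (f i))"
    using Linf_boundedI[of "\<lambda>l x. \<Sum>i\<in>I. f i l x", OF m b] by blast+
qed

lemma Linf_uminus:
  assumes \<beta>: "\<beta> \<in> Linf \<Omega> L"
  shows "(\<lambda>l x. - \<beta> l x) \<in> Linf \<Omega> L" and "Linf_norm \<Omega> L (\<lambda>l x. - \<beta> l x) \<le> Linf_norm \<Omega> L \<beta>"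
  using Linf_boundedI[of "\<lambda>l x. - \<beta> l x" "Linf_norm \<Omega> L \<beta>"]
    Linf_measurable[OF \<beta>] AE_abs_le_Linf_norm[OF \<beta>] by auto

lemma Linf_norm_scaled_le:
  assumes \<gamma>: "\<gamma> \<in> Linf \<Omega> L" and \<beta>: "\<beta> \<in> Linf \<Omega> L"
    and eq: "Linf_eq \<Omega> L \<gamma> (\<lambda>l x. c * \<beta> l x)" and c: "0 \<le> c"
  shows "Linf_norm \<Omega> L \<gamma> \<le> c * Linf_norm \<Omega> L \<beta>"
proof (rule Linf_boundedI(2))
  fix l assume l: "l \<in> {2..L}"
  show "\<gamma> l \<in> borel_measurable (lebesgue_on \<Omega>)"
    using Linf_measurable[OF \<gamma> l] .
  have "AE x in lebesgue_on \<Omega>. \<gamma> l x = c * \<beta> l x"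
    using eq l by (simp add: Linf_eq_def)
  then show "AE x in lebesgue_on \<Omega>. \<bar>\<gamma> l x\<bar> \<le> c * Linf_norm \<Omega> L \<beta>"
    using AE_abs_le_Linf_norm[OF \<beta> l]
    by eventually_elim (use c in \<open>auto simp: abs_mult intro: mult_left_mono\<close>)
qed

text \<open>The space is complete: a series with summable norms converges pointwise almost everywhere, and
  the tails of the numerical series bound the error uniformly.\<close>

lemma Linf_series_convergesI:
  assumes a: "\<And>m. 1 \<le> m \<Longrightarrow> a m \<in> Linf \<Omega> L"
    and bd: "\<And>M. (\<Sum>m=1..M. Linf_norm \<Omega> L (a m)) \<le> y"
  shows "Linf_series_converges \<Omega> L a"
proof -
  define \<alpha> where "\<alpha> = (\<lambda>m. Linf_norm \<Omega> L (a (Suc m)))"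
  have \<alpha>_nonneg: "0 \<le> \<alpha> m" for m
    unfolding \<alpha>_def by (intro Linf_norm_nonneg a) simp
  have "(\<Sum>m<M. \<alpha> m) \<le> y" for M
    using bd[of M] by (simp add: \<alpha>_def sum.atLeast1_atMost_eq)
  then have \<alpha>: "summable \<alpha>"
    using \<alpha>_nonneg by (intro summableI_nonneg_bounded)
  define \<beta> where "\<beta> = (\<lambda>l x. \<Sum>m. a (Suc m) l x)"
  have meas: "a (Suc m) l \<in> borel_measurable (lebesgue_on \<Omega>)" if "l \<in> {2..L}" for m l
    using that by (intro Linf_measurable a) simp_all
  have meas_\<beta>: "\<beta> l \<in> borel_measurable (lebesgue_on \<Omega>)" if "l \<in> {2..L}" for l
    unfolding \<beta>_def using meas[OF that] by (intro borel_measurable_suminf)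
  have ae: "AE x in lebesgue_on \<Omega>. \<forall>m. \<bar>a (Suc m) l x\<bar> \<le> \<alpha> m" if l: "l \<in> {2..L}" for l
    unfolding AE_all_countable \<alpha>_def using AE_abs_le_Linf_norm[OF a l] by auto
  have err: "AE x in lebesgue_on \<Omega>. \<bar>(\<Sum>m=1..N. a m l x) - \<beta> l x\<bar> \<le> suminf \<alpha> - (\<Sum>m<N. \<alpha> m)"
    if l: "l \<in> {2..L}" for l N
    using ae[OF l]
  proof eventually_elim
    case (elim x)
    let ?f = "\<lambda>m. a (Suc m) l x"
    have f: "summable ?f"
      using elim by (intro summable_comparison_test'[OF \<alpha>, of 0]) auto
    have "(\<Sum>m=1..N. a m l x) - \<beta> l x = - (\<Sum>m. ?f (m + N))"
      unfolding \<beta>_def suminf_minus_initial_segment[OF f] by (simp add: sum.atLeast1_atMost_eq)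
    also have "\<bar>\<dots>\<bar> = norm (\<Sum>m. ?f (m + N))"
      by simp
    also have "\<dots> \<le> (\<Sum>m. \<alpha> (m + N))"
      using elim by (intro norm_suminf_le summable_ignore_initial_segment[OF \<alpha>]) auto
    also have "\<dots> = suminf \<alpha> - (\<Sum>m<N. \<alpha> m)"
      by (rule suminf_minus_initial_segment[OF \<alpha>])
    finally show ?case .
  qed
  have \<beta>: "\<beta> \<in> Linf \<Omega> L"
  proof (rule Linf_boundedI(1)[OF meas_\<beta>])
    show "AE x in lebesgue_on \<Omega>. \<bar>\<beta> l x\<bar> \<le> suminf \<alpha>" if "l \<in> {2..L}" for l
      using err[OF that, of 0] by simp
  qed
  let ?d = "\<lambda>N. Linf_norm \<Omega> L (\<lambda>l x. (\<Sum>m=1..N. a m l x) - \<beta> l x)"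
  have d: "0 \<le> ?d N \<and> ?d N \<le> suminf \<alpha> - (\<Sum>m<N. \<alpha> m)" for N
  proof -
    have m: "(\<lambda>x. (\<Sum>m=1..N. a m l x) - \<beta> l x) \<in> borel_measurable (lebesgue_on \<Omega>)"
      if "l \<in> {2..L}" for l
      unfolding One_nat_def sum.atLeast1_atMost_eq using meas[OF that] meas_\<beta>[OF that]
      by (intro borel_measurable_diff borel_measurable_sum)
    from Linf_boundedI[of "\<lambda>l x. (\<Sum>m=1..N. a m l x) - \<beta> l x", OF m err]
    show ?thesis
      using Linf_norm_nonneg by blast
  qed
  have "(\<lambda>N. suminf \<alpha> - (\<Sum>m<N. \<alpha> m)) \<longlonglongrightarrow> suminf \<alpha> - suminf \<alpha>"
    using summable_LIMSEQ[OF \<alpha>] by (intro tendsto_intros)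
  then have "?d \<longlonglongrightarrow> 0"
    using d by (intro tendsto_sandwich[of "\<lambda>_. 0" ?d sequentially
          "\<lambda>N. suminf \<alpha> - (\<Sum>m<N. \<alpha> m)"]) auto
  then show ?thesis
    unfolding Linf_series_converges_def using a \<beta> by blast
qed

text \<open>Normalize the argument to norm \<open>1\<close>.  This fails for \<open>C_norm S \<phi> = 0\<close>, where \<open>\<phi>\<close> may be nonzero outside
  \<open>S\<close>; there the boundedness of \<open>T\<close> gives norm \<open>0\<close> for \<open>T \<phi>\<close>.\<close>

lemma bounded_linear_C_Linf_norm_le:
  assumes S: "S = frontier \<Omega> \<times> frontier \<Omega>" "compact S" "S \<noteq> {}"
    and T: "bounded_linear_C_Linf \<Omega> L T" and \<phi>: "continuous_on S \<phi>"
  shows "Linf_norm \<Omega> L (T \<phi>) \<le> op_norm_C_Linf \<Omega> L T * C_norm S \<phi>"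
proof -
  obtain M where M: "\<And>\<phi>. continuous_on S \<phi> \<Longrightarrow> Linf_norm \<Omega> L (T \<phi>) \<le> M * C_norm S \<phi>"
    using T unfolding bounded_linear_C_Linf_def Let_def S(1) by blast
  have mem: "T \<phi> \<in> Linf \<Omega> L" if "continuous_on S \<phi>" for \<phi>
    using T that unfolding bounded_linear_C_Linf_def Let_def S(1) by blast
  have scale: "Linf_eq \<Omega> L (T (\<lambda>p. c * \<phi> p)) (\<lambda>l x. c * T \<phi> l x)" if "continuous_on S \<phi>" for c \<phi>
    using T that unfolding bounded_linear_C_Linf_def Let_def S(1) by blast
  have nonneg: "0 \<le> C_norm S \<phi>" if "continuous_on S \<phi>" for \<phi>
    using abs_le_C_norm[OF S(2) that] S(3) by (meson abs_ge_zero ex_in_conv order_trans)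
  define c where "c = C_norm S \<phi>"
  show ?thesis
  proof (cases "c = 0")
    case True
    then show ?thesis
      using M[OF \<phi>] by (simp add: c_def)
  next
    case False
    then have c: "0 < c"
      using nonneg[OF \<phi>] by (simp add: c_def)
    define \<psi> where "\<psi> = (\<lambda>p. \<phi> p / c)"
    have \<psi>: "continuous_on S \<psi>"
      unfolding \<psi>_def using \<phi> c by (intro continuous_intros) auto
    have "C_norm S \<psi> \<le> 1"
      using abs_le_C_norm[OF S(2) \<phi>] c by (intro C_norm_le S(3)) (simp add: \<psi>_def c_def)
    moreover have "bdd_above ((\<lambda>\<phi>. Linf_norm \<Omega> L (T \<phi>)) ` {\<phi>. continuous_on S \<phi> \<and> C_norm S \<phi> \<le> 1})"
    proof (rule bdd_aboveI2)
      fix \<phi> assume \<phi>: "\<phi> \<in> {\<phi>. continuous_on S \<phi> \<and> C_norm S \<phi> \<le> 1}"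
      have "M * C_norm S \<phi> \<le> \<bar>M\<bar> * C_norm S \<phi>"
        using nonneg \<phi> by (intro mult_right_mono) auto
      also have "\<dots> \<le> \<bar>M\<bar> * 1"
        using \<phi> by (intro mult_left_mono) auto
      finally show "Linf_norm \<Omega> L (T \<phi>) \<le> \<bar>M\<bar>"
        using M[of \<phi>] \<phi> by auto
    qed
    ultimately have le: "Linf_norm \<Omega> L (T \<psi>) \<le> op_norm_C_Linf \<Omega> L T"
      unfolding op_norm_C_Linf_def Let_def S(1)[symmetric] using \<psi> by (intro cSUP_upper) auto
    have "(\<lambda>p. c * \<psi> p) = \<phi>"
      using c by (simp add: \<psi>_def)
    then have "Linf_norm \<Omega> L (T \<phi>) \<le> c * Linf_norm \<Omega> L (T \<psi>)"
      using scale[OF \<psi>, of c] mem[OF \<phi>] mem[OF \<psi>] c by (intro Linf_norm_scaled_le) auto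
    also have "\<dots> \<le> c * op_norm_C_Linf \<Omega> L T"
      using le c by (intro mult_left_mono) auto
    finally show ?thesis
      by (simp add: c_def mult.commute)
  qed
qed

end

section \<open>Bounds for the forward operators\<close>

locale born_setting = weakly_singular_kernel \<Omega> G A \<alpha> + Linf_space \<Omega> L
  for \<Omega> :: "'a::euclidean_space set" and G A \<alpha> L +
  fixes k :: real and u0 :: "'a \<times> 'a \<Rightarrow> real" and U \<mu> :: real
  assumes u0_cont: "continuous_on (closure \<Omega> \<times> frontier \<Omega>) u0"
    and frontier_nonempty: "frontier \<Omega> \<noteq> {}"
    and U_def: "U = C_norm (closure \<Omega> \<times> frontier \<Omega>) u0"
    and \<mu>_def: "\<mu> = k\<^sup>2 * (SUP x\<in>\<Omega>. LINT y|lebesgue_on \<Omega>. \<bar>G x y\<bar>)"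
begin

abbreviation D where "D \<equiv> closure \<Omega> \<times> frontier \<Omega>"
abbreviation S where "S \<equiv> frontier \<Omega> \<times> frontier \<Omega>"
abbreviation N where "N \<equiv> Linf_norm \<Omega> L"

lemma compact_frontier_dom: "compact (frontier \<Omega>)"
  using bounded_\<Omega> by (rule compact_frontier_bounded)

lemma compact_D: "compact D"
  using bounded_\<Omega> compact_frontier_dom by (intro compact_Times) (auto simp: compact_closure)

lemma compact_S: "compact S"
  using compact_frontier_dom by (intro compact_Times)

lemma S_subset_D: "S \<subseteq> D"
  by (auto simp: frontier_def)

lemma S_nonempty: "S \<noteq> {}"
  using frontier_nonempty by auto

lemma abs_u0_le: "p \<in> D \<Longrightarrow> \<bar>u0 p\<bar> \<le> U"
  unfolding U_def using compact_D u0_cont by (rule abs_le_C_norm)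

lemma U_nonneg: "0 \<le> U"
  using S_nonempty S_subset_D abs_u0_le by (meson abs_ge_zero ex_in_conv order_trans subsetD)

lemma kernel_integral_nonneg: "0 \<le> (LINT y|lebesgue_on \<Omega>. \<bar>G x y\<bar>)"
  by (intro Bochner_Integration.integral_nonneg) simp

lemma kernel_integral_le: "x \<in> closure \<Omega> \<Longrightarrow> k\<^sup>2 * (LINT y|lebesgue_on \<Omega>. \<bar>G x y\<bar>) \<le> \<mu>"
  unfolding \<mu>_def by (intro mult_left_mono kernel_integral_le_SUP) auto

lemma \<mu>_nonneg: "0 \<le> \<mu>"
proof -
  obtain x where "x \<in> closure \<Omega>"
    using nonempty_dom closure_subset by fastforce
  then show ?thesis
    using kernel_integral_le[of x] kernel_integral_nonneg[of x]
    by (meson order_trans mult_nonneg_nonneg zero_le_power2)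
qed

lemma slice_measurable:
  assumes "continuous_on D v" "s \<in> frontier \<Omega>"
  shows "(\<lambda>y. v (y, s)) \<in> borel_measurable (lebesgue_on \<Omega>)"
proof (intro continuous_imp_measurable_on_sets_lebesgue sets_\<Omega>)
  show "continuous_on \<Omega> (\<lambda>y. v (y, s))"
    using assms closure_subset[of \<Omega>]
    by (intro continuous_on_compose2[OF assms(1)] continuous_intros) auto
qed

text \<open>Continuity of the result is what allows the operator to be applied again: it makes the slices
  \<open>v(\<cdot>, s)\<close> measurable.\<close>

lemma b_op_bounded:
  assumes v: "continuous_on D v" "\<And>p. p \<in> D \<Longrightarrow> \<bar>v p\<bar> \<le> V"
    and \<beta>: "\<beta> \<in> Linf \<Omega> L" and l: "l \<in> {2..L}"
  shows "continuous_on D (b_op \<Omega> k G l v \<beta>)"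
    and "p \<in> D \<Longrightarrow> \<bar>b_op \<Omega> k G l v \<beta> p\<bar> \<le> \<mu> * V * N \<beta>"
proof -
  have V: "0 \<le> V"
    using v(2) S_nonempty S_subset_D by (meson abs_ge_zero ex_in_conv order_trans subsetD)
  have N: "0 \<le> N \<beta>"
    using \<beta> by (rule Linf_norm_nonneg)
  have meas: "(\<lambda>y. \<beta> l y * v (y, s)) \<in> borel_measurable (lebesgue_on \<Omega>)" if "s \<in> frontier \<Omega>" for s
    using Linf_measurable[OF \<beta> l] slice_measurable[OF v(1) that] by (rule borel_measurable_times)
  have bd: "AE y in lebesgue_on \<Omega>. \<bar>\<beta> l y * v (y, s)\<bar> \<le> N \<beta> * V" if s: "s \<in> frontier \<Omega>" for s
  proof -
    have "AE y in lebesgue_on \<Omega>. y \<in> \<Omega>"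
      by (rule AE_I2) auto
    then show ?thesis
      using AE_abs_le_Linf_norm[OF \<beta> l]
    proof eventually_elim
      case (elim y)
      then have "\<bar>v (y, s)\<bar> \<le> V"
        using s closure_subset[of \<Omega>] by (intro v(2)) auto
      then show ?case
        using elim N by (auto simp: abs_mult intro: mult_mono)
    qed
  qed
  have eq: "b_op \<Omega> k G l v \<beta> q =
      - k\<^sup>2 * (LINT y|lebesgue_on \<Omega>. G (fst q) y * (\<beta> l y * v (y, snd q)))" for q
    by (simp add: b_op_def case_prod_unfold mult.assoc)
  show "continuous_on D (b_op \<Omega> k G l v \<beta>)"
    unfolding continuous_on_sequentially
  proof (intro ballI allI impI)
    fix q :: "nat \<Rightarrow> 'a \<times> 'a" and p
    assume p: "p \<in> D" and q: "(\<forall>n. q n \<in> D) \<and> q \<longlonglongrightarrow> p"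
    have "(\<lambda>n. LINT y|lebesgue_on \<Omega>. G (fst (q n)) y * (\<beta> l y * v (y, snd (q n))))
        \<longlonglongrightarrow> (LINT y|lebesgue_on \<Omega>. G (fst p) y * (\<beta> l y * v (y, snd p)))"
    proof (rule kernel_integral_tendsto)
      show "fst (q n) \<in> closure \<Omega>" for n
        using q by (auto simp: mem_Times_iff)
      show "(\<lambda>n. fst (q n)) \<longlonglongrightarrow> fst p"
        using q by (intro tendsto_fst) auto
      show "fst p \<in> closure \<Omega>"
        using p by auto
      have sq: "snd (q n) \<in> frontier \<Omega>" for n
        using q by (auto simp: mem_Times_iff)
      have sp: "snd p \<in> frontier \<Omega>"
        using p by auto
      show "(\<lambda>y. \<beta> l y * v (y, snd (q n))) \<in> borel_measurable (lebesgue_on \<Omega>)"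
        "AE y in lebesgue_on \<Omega>. \<bar>\<beta> l y * v (y, snd (q n))\<bar> \<le> N \<beta> * V" for n
        using meas[OF sq] bd[OF sq] by auto
      show "(\<lambda>y. \<beta> l y * v (y, snd p)) \<in> borel_measurable (lebesgue_on \<Omega>)"
        "AE y in lebesgue_on \<Omega>. \<bar>\<beta> l y * v (y, snd p)\<bar> \<le> N \<beta> * V"
        using meas[OF sp] bd[OF sp] by auto
      show "(\<lambda>n. \<beta> l y * v (y, snd (q n))) \<longlonglongrightarrow> \<beta> l y * v (y, snd p)" if "y \<in> \<Omega>" for y
      proof (intro tendsto_mult tendsto_const continuous_on_tendsto_compose[OF v(1)])
        show "(\<lambda>n. (y, snd (q n))) \<longlonglongrightarrow> (y, snd p)"
          using q by (intro tendsto_Pair tendsto_const tendsto_snd) auto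
      qed (use that sq sp closure_subset[of \<Omega>] in auto)
      show "0 \<le> N \<beta> * V"
        using N V by simp
    qed
    then show "(b_op \<Omega> k G l v \<beta> \<circ> q) \<longlonglongrightarrow> b_op \<Omega> k G l v \<beta> p"
      unfolding o_def eq by (intro tendsto_mult tendsto_const)
  qed
  show "\<bar>b_op \<Omega> k G l v \<beta> p\<bar> \<le> \<mu> * V * N \<beta>" if p: "p \<in> D"
  proof -
    obtain x s where xs: "p = (x, s)" "x \<in> closure \<Omega>" "s \<in> frontier \<Omega>"
      using p by auto
    let ?w = "\<lambda>y. \<beta> l y * v (y, s)"
    have int: "integrable (lebesgue_on \<Omega>) (\<lambda>y. G x y * ?w y)"
      using kernel_mult_integrable[OF xs(2) meas[OF xs(3)] bd[OF xs(3)]] .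
    have "\<bar>LINT y|lebesgue_on \<Omega>. G x y * ?w y\<bar> \<le> (LINT y|lebesgue_on \<Omega>. \<bar>G x y * ?w y\<bar>)"
      by (rule integral_abs_bound)
    also have "\<dots> \<le> (LINT y|lebesgue_on \<Omega>. \<bar>G x y\<bar> * (N \<beta> * V))"
    proof (rule integral_mono_AE)
      show "integrable (lebesgue_on \<Omega>) (\<lambda>y. \<bar>G x y * ?w y\<bar>)"
        using int by (rule integrable_abs)
      show "integrable (lebesgue_on \<Omega>) (\<lambda>y. \<bar>G x y\<bar> * (N \<beta> * V))"
        using integrable_abs[OF kernel_integrable[OF xs(2)]] by (rule integrable_mult_left)
      show "AE y in lebesgue_on \<Omega>. \<bar>G x y * ?w y\<bar> \<le> \<bar>G x y\<bar> * (N \<beta> * V)"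
        using bd[OF xs(3)] by eventually_elim (simp add: abs_mult[of "G x _"] mult_left_mono)
    qed
    also have "\<dots> = (LINT y|lebesgue_on \<Omega>. \<bar>G x y\<bar>) * (N \<beta> * V)"
      by simp
    finally have "k\<^sup>2 * \<bar>LINT y|lebesgue_on \<Omega>. G x y * ?w y\<bar> \<le>
        k\<^sup>2 * (LINT y|lebesgue_on \<Omega>. \<bar>G x y\<bar>) * (N \<beta> * V)"
      unfolding mult.assoc by (rule mult_left_mono) simp
    also have "\<dots> \<le> \<mu> * (N \<beta> * V)"
      using N V xs by (intro mult_right_mono kernel_integral_le) auto
    finally show ?thesis
      unfolding eq by (simp add: xs abs_mult mult_ac)
  qed
qed

text \<open>Continuity is included so that the notion reproduces itself under \<open>b_op\<close> and the pseudoinverse can be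
  applied to the values.\<close>

definition multi_op_bounded :: "nat \<Rightarrow> 'a multi_op \<Rightarrow> real \<Rightarrow> bool" where
  "multi_op_bounded n T c \<longleftrightarrow> (\<forall>\<beta>s. length \<beta>s = n \<longrightarrow> set \<beta>s \<subseteq> Linf \<Omega> L \<longrightarrow>
     continuous_on D (T \<beta>s) \<and> (\<forall>p\<in>D. \<bar>T \<beta>s p\<bar> \<le> c * prod_list (map N \<beta>s)))"

lemma multi_op_boundedD:
  assumes "multi_op_bounded n T c" "length \<beta>s = n" "set \<beta>s \<subseteq> Linf \<Omega> L"
  shows "continuous_on D (T \<beta>s)" "p \<in> D \<Longrightarrow> \<bar>T \<beta>s p\<bar> \<le> c * prod_list (map N \<beta>s)"
  using assms by (auto simp: multi_op_bounded_def)

lemma prod_norms_nonneg: "set \<beta>s \<subseteq> Linf \<Omega> L \<Longrightarrow> 0 \<le> prod_list (map N \<beta>s)"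
  by (intro prod_list_nonneg) (auto intro!: Linf_norm_nonneg)

lemma tensor_bounded:
  assumes "\<And>i. i \<in> set is \<Longrightarrow> multi_op_bounded i (T i) (c i)" "\<And>i. 0 \<le> c i"
  shows "multi_op_bounded (sum_list is) (tensor (map (\<lambda>i. (i, T i)) is)) (prod_list (map c is))"
  using assms
proof (induction "is")
  case Nil
  then show ?case
    by (auto simp: multi_op_bounded_def)
next
  case (Cons i "is")
  let ?t = "tensor (map (\<lambda>i. (i, T i)) is)"
  have IH: "multi_op_bounded (sum_list is) ?t (prod_list (map c is))"
    using Cons by auto
  show ?case
    unfolding multi_op_bounded_def
  proof (intro allI impI conjI ballI)
    fix \<beta>s :: "'a coeffs list"
    assume len: "length \<beta>s = sum_list (i # is)" and mem: "set \<beta>s \<subseteq> Linf \<Omega> L"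
    have t: "length (take i \<beta>s) = i" "set (take i \<beta>s) \<subseteq> Linf \<Omega> L"
      using len mem set_take_subset[of i \<beta>s] by auto
    have d: "length (drop i \<beta>s) = sum_list is" "set (drop i \<beta>s) \<subseteq> Linf \<Omega> L"
      using len mem set_drop_subset[of i \<beta>s] by auto
    have bi: "multi_op_bounded i (T i) (c i)"
      using Cons.prems(1) by simp
    note Ti = multi_op_boundedD[OF bi t] and Ts = multi_op_boundedD[OF IH d]
    show "continuous_on D (tensor (map (\<lambda>i. (i, T i)) (i # is)) \<beta>s)"
      using Ti(1) Ts(1) by (auto intro: continuous_on_mult)
    fix p assume p: "p \<in> D"
    have "\<bar>T i (take i \<beta>s) p\<bar> * \<bar>?t (drop i \<beta>s) p\<bar> \<le>
        (c i * prod_list (map N (take i \<beta>s))) * (prod_list (map c is) * prod_list (map N (drop i \<beta>s)))"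
      using Ti(2)[OF p] Ts(2)[OF p] Cons.prems(2) prod_norms_nonneg[OF t(2)]
      by (intro mult_mono) auto
    also have "\<dots> = c i * prod_list (map c is) * (prod_list (map N (take i \<beta>s)) * prod_list (map N (drop i \<beta>s)))"
      by (simp only: mult_ac)
    also have "prod_list (map N (take i \<beta>s)) * prod_list (map N (drop i \<beta>s)) = prod_list (map N \<beta>s)"
      by (metis append_take_drop_id map_append prod_list.append)
    finally show "\<bar>tensor (map (\<lambda>i. (i, T i)) (i # is)) \<beta>s p\<bar> \<le>
        prod_list (map c (i # is)) * prod_list (map N \<beta>s)"
      by (simp add: abs_mult)
  qed
qed

text \<open>The recursions of \<open>born_op\<close> and \<open>majorant\<close> correspond: tensor products multiply the bounds and
  \<open>B\<^bsup>(l)\<^esup>\<close> contributes \<open>\<mu>\<close> times the norm of the last coefficient vector.\<close>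

lemma born_op_bounded: "multi_op_bounded n (born_op \<Omega> k G L u0 n) (majorant L \<mu> U n)"
proof (induction n rule: less_induct)
  case (less n)
  show ?case
  proof (cases n)
    case 0
    then show ?thesis
      using u0_cont abs_u0_le by (auto simp: multi_op_bounded_def)
  next
    case (Suc m)
    let ?t = "\<lambda>is. tensor (map (\<lambda>i. (i, born_op \<Omega> k G L u0 i)) is)"
    let ?c = "\<lambda>is. prod_list (map (majorant L \<mu> U) is)"
    have t: "multi_op_bounded m (?t is) (?c is)" if "is": "is \<in> index_tuples l m" for l "is"
    proof -
      have "multi_op_bounded (sum_list is) (?t is) (?c is)"
        using "is" by (intro tensor_bounded less majorant_nonneg \<mu>_nonneg U_nonneg)
          (auto simp: index_tuples_def Suc)
      then show ?thesis
        using "is" by (simp add: index_tuples_def)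
    qed
    show ?thesis
      unfolding multi_op_bounded_def
    proof (intro allI impI)
      fix \<beta>s :: "'a coeffs list"
      assume len: "length \<beta>s = n" and mem: "set \<beta>s \<subseteq> Linf \<Omega> L"
      define \<gamma>s \<beta> where "\<gamma>s = butlast \<beta>s" and "\<beta> = last \<beta>s"
      have \<beta>s: "\<beta>s = \<gamma>s @ [\<beta>]"
        using len Suc by (cases \<beta>s rule: rev_cases) (auto simp: \<gamma>s_def \<beta>_def)
      have \<gamma>s: "length \<gamma>s = m" "set \<gamma>s \<subseteq> Linf \<Omega> L" and \<beta>: "\<beta> \<in> Linf \<Omega> L"
        using len mem Suc by (auto simp: \<beta>s)
      let ?v = "\<lambda>l q. \<Sum>is\<in>index_tuples l m. ?t is \<gamma>s q"
      let ?V = "\<lambda>l. (\<Sum>is\<in>index_tuples l m. ?c is) * prod_list (map N \<gamma>s)"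
      have v: "continuous_on D (?v l)" for l
        using multi_op_boundedD(1)[OF t \<gamma>s] by (intro continuous_on_sum)
      have V: "\<bar>?v l p\<bar> \<le> ?V l" if "p \<in> D" for l p
        using multi_op_boundedD(2)[OF t \<gamma>s that] unfolding sum_distrib_right
        by (intro order_trans[OF sum_abs] sum_mono)
      have eq: "born_op \<Omega> k G L u0 n \<beta>s = (\<lambda>q. \<Sum>l=2..L. b_op \<Omega> k G l (?v l) \<beta> q)"
        by (simp add: Suc B_op_def \<beta>s)
      have "continuous_on D (born_op \<Omega> k G L u0 n \<beta>s)"
        unfolding eq by (intro continuous_on_sum b_op_bounded(1)[OF v V \<beta>])
      moreover have "\<bar>born_op \<Omega> k G L u0 n \<beta>s p\<bar> \<le> majorant L \<mu> U n * prod_list (map N \<beta>s)"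
        if p: "p \<in> D" for p
      proof -
        have "\<bar>born_op \<Omega> k G L u0 n \<beta>s p\<bar> \<le> (\<Sum>l=2..L. \<mu> * ?V l * N \<beta>)"
          unfolding eq by (intro order_trans[OF sum_abs] sum_mono b_op_bounded(2)[OF v V \<beta> _ p])
        also have "\<dots> = majorant L \<mu> U n * prod_list (map N \<beta>s)"
          by (simp add: Suc \<beta>s sum_distrib_left sum_distrib_right mult_ac)
        finally show ?thesis .
      qed
      ultimately show "continuous_on D (born_op \<Omega> k G L u0 n \<beta>s) \<and>
          (\<forall>p\<in>D. \<bar>born_op \<Omega> k G L u0 n \<beta>s p\<bar> \<le> majorant L \<mu> U n * prod_list (map N \<beta>s))"
        by blast
    qed
  qed
qed

section \<open>Bounds for the inverse operators\<close>

lemma finite_pos_index_tuples: "finite (pos_index_tuples n m)"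
proof (rule finite_subset)
  show "pos_index_tuples n m \<subseteq> {is. set is \<subseteq> {..m} \<and> length is = n}"
    by (auto simp: pos_index_tuples_def member_le_sum_list)
qed (rule finite_lists_length_eq, simp)

context
  fixes T :: "('a \<times> 'a \<Rightarrow> real) \<Rightarrow> 'a coeffs" and \<phi> :: "'a \<times> 'a \<Rightarrow> real"
  assumes T: "bounded_linear_C_Linf \<Omega> L T" and \<phi>: "continuous_on S \<phi>"
begin

abbreviation inv_op where "inv_op m \<equiv> inv_born_op \<Omega> k G L u0 T m \<phi>"

lemma op_norm_nonneg: "0 \<le> op_norm_C_Linf \<Omega> L T"
proof -
  have one: "continuous_on S (\<lambda>_. 1 :: real)" "C_norm S (\<lambda>_. 1) = 1"
    using S_nonempty by (auto simp: C_norm_def)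
  have "T (\<lambda>_. 1) \<in> Linf \<Omega> L"
    using T one(1) unfolding bounded_linear_C_Linf_def Let_def by blast
  then have "0 \<le> N (T (\<lambda>_. 1))"
    by (rule Linf_norm_nonneg)
  also have "\<dots> \<le> op_norm_C_Linf \<Omega> L T"
    using bounded_linear_C_Linf_norm_le[OF refl compact_S S_nonempty T one(1)] one(2) by simp
  finally show ?thesis .
qed

lemma inverse_summand_bounded:
  assumes \<beta>s: "length \<beta>s = n" "set \<beta>s \<subseteq> Linf \<Omega> L"
  defines "f \<equiv> restrict (born_op \<Omega> k G L u0 n \<beta>s) S"
  shows "T f \<in> Linf \<Omega> L"
    and "N (T f) \<le> op_norm_C_Linf \<Omega> L T * (majorant L \<mu> U n * prod_list (map N \<beta>s))"
proof -
  note b = multi_op_boundedD[OF born_op_bounded \<beta>s]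
  have f: "continuous_on S f"
    using continuous_on_subset[OF b(1) S_subset_D] by (simp add: f_def cong: continuous_on_cong)
  show "T f \<in> Linf \<Omega> L"
    using T f unfolding bounded_linear_C_Linf_def Let_def by blast
  have "N (T f) \<le> op_norm_C_Linf \<Omega> L T * C_norm S f"
    by (rule bounded_linear_C_Linf_norm_le[OF refl compact_S S_nonempty T f])
  also have "\<dots> \<le> op_norm_C_Linf \<Omega> L T * (majorant L \<mu> U n * prod_list (map N \<beta>s))"
    using b(2) S_subset_D
    by (intro mult_left_mono op_norm_nonneg C_norm_le S_nonempty) (auto simp: f_def)
  finally show "N (T f) \<le> op_norm_C_Linf \<Omega> L T * (majorant L \<mu> U n * prod_list (map N \<beta>s))" .
qed

text \<open>Membership of the earlier terms is assumed because the norm bounds are only meaningful on \<open>Linf\<close>;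
  the first conclusion is the induction step that discharges it.\<close>

lemma inverse_sum_bounded:
  assumes m: "2 \<le> m" and mem: "\<And>i. i < m \<Longrightarrow> inv_op i \<in> Linf \<Omega> L"
  shows "inv_op m \<in> Linf \<Omega> L"
    and "N (inv_op m) \<le> op_norm_C_Linf \<Omega> L T *
      (\<Sum>n=2..m. \<Sum>is\<in>pos_index_tuples n m. majorant L \<mu> U n * prod_list (map (\<lambda>i. N (inv_op i)) is))"
proof -
  obtain m' where m': "m = Suc (Suc m')"
    using m by (metis add_2_eq_Suc le_Suc_ex)
  let ?F = "\<lambda>n is. T (restrict (born_op \<Omega> k G L u0 n (map inv_op is)) S)"
  let ?b = "\<lambda>n is. op_norm_C_Linf \<Omega> L T *
      (majorant L \<mu> U n * prod_list (map (\<lambda>i. N (inv_op i)) is))"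
  have F: "?F n is \<in> Linf \<Omega> L" "N (?F n is) \<le> ?b n is"
    if n: "n \<in> {2..m}" and "is": "is \<in> pos_index_tuples n m" for n "is"
  proof -
    have len: "length (map inv_op is) = n"
      using "is" by (simp add: pos_index_tuples_def)
    have set: "set (map inv_op is) \<subseteq> Linf \<Omega> L"
      using pos_index_tuples_less[OF "is"] n by (auto intro!: mem)
    show "?F n is \<in> Linf \<Omega> L" "N (?F n is) \<le> ?b n is"
      using inverse_summand_bounded[OF len set] by (simp_all add: o_def)
  qed
  have F1: "(\<lambda>l x. \<Sum>is\<in>pos_index_tuples n m. ?F n is l x) \<in> Linf \<Omega> L"
    "N (\<lambda>l x. \<Sum>is\<in>pos_index_tuples n m. ?F n is l x) \<le> (\<Sum>is\<in>pos_index_tuples n m. ?b n is)"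
    if n: "n \<in> {2..m}" for n
  proof -
    note s = Linf_sum[of "pos_index_tuples n m" "?F n", OF finite_pos_index_tuples F(1)[OF n]]
    show "(\<lambda>l x. \<Sum>is\<in>pos_index_tuples n m. ?F n is l x) \<in> Linf \<Omega> L"
      using s(1) by simp
    show "N (\<lambda>l x. \<Sum>is\<in>pos_index_tuples n m. ?F n is l x) \<le> (\<Sum>is\<in>pos_index_tuples n m. ?b n is)"
      using F(2)[OF n] by (intro order_trans[OF s(2)] sum_mono) auto
  qed
  let ?H = "\<lambda>n l x. \<Sum>is\<in>pos_index_tuples n m. ?F n is l x"
  note s = Linf_sum[of "{2..m}" ?H, OF _ F1(1), simplified]
  have eq: "inv_op m = (\<lambda>l x. - (\<Sum>n=2..m. ?H n l x))"
    by (simp add: m')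
  show "inv_op m \<in> Linf \<Omega> L"
    unfolding eq by (rule Linf_uminus(1)[OF s(1)])
  have "N (inv_op m) \<le> N (\<lambda>l x. \<Sum>n=2..m. ?H n l x)"
    unfolding eq by (rule Linf_uminus(2)[OF s(1)])
  also have "\<dots> \<le> (\<Sum>n=2..m. N (?H n))"
    by (rule s(2))
  also have "\<dots> \<le> (\<Sum>n=2..m. \<Sum>is\<in>pos_index_tuples n m. ?b n is)"
    by (intro sum_mono F1(2))
  finally show "N (inv_op m) \<le> op_norm_C_Linf \<Omega> L T *
      (\<Sum>n=2..m. \<Sum>is\<in>pos_index_tuples n m. majorant L \<mu> U n * prod_list (map (\<lambda>i. N (inv_op i)) is))"
    by (simp only: sum_distrib_left)
qed

lemma inv_op_in_Linf: "inv_op m \<in> Linf \<Omega> L"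
proof (induction m rule: less_induct)
  case (less m)
  consider "m = 0" | "m = Suc 0" | "2 \<le> m"
    by linarith
  then show ?case
  proof cases
    case 1
    then show ?thesis
      by (simp, intro Linf_boundedI(1)[of _ 0]) auto
  next
    case 2
    then show ?thesis
      using T \<phi> unfolding bounded_linear_C_Linf_def Let_def by simp
  next
    case 3
    then show ?thesis
      using less by (rule inverse_sum_bounded(1))
  qed
qed

lemma inv_op_norm_le:
  assumes "2 \<le> m"
  shows "N (inv_op m) \<le> op_norm_C_Linf \<Omega> L T *
    (\<Sum>n=2..m. \<Sum>is\<in>pos_index_tuples n m. majorant L \<mu> U n * prod_list (map (\<lambda>i. N (inv_op i)) is))"
  using assms inv_op_in_Linf by (rule inverse_sum_bounded(2))

end

end

section \<open>Convergence of the inverse Born series\<close>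

text \<open>A possibly negative exponent in the bound on \<open>G\<close> can be replaced by \<open>0\<close>, since \<open>\<Omega>\<close> is bounded.\<close>

lemma neumann_green_weakly_singular:
  assumes \<Omega>: "open \<Omega>" "bounded \<Omega>" and G: "neumann_green \<Omega> k G"
  obtains A \<alpha> where "weakly_singular_kernel \<Omega> G A \<alpha>"
proof -
  from G obtain A \<alpha> :: real where \<alpha>: "\<alpha> < DIM('a)"
    and bd: "\<And>x y. x \<in> closure \<Omega> \<Longrightarrow> y \<in> \<Omega> \<Longrightarrow> x \<noteq> y \<Longrightarrow> \<bar>G x y\<bar> \<le> A * dist x y powr (- \<alpha>)"
    and cont: "continuous_on {(x, y). x \<in> closure \<Omega> \<and> y \<in> \<Omega> \<and> x \<noteq> y} (\<lambda>(x, y). G x y)"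
    unfolding neumann_green_def by blast
  have bd': "\<bar>G x y\<bar> \<le> \<bar>A\<bar> * dist x y powr (- \<alpha>)" if "x \<in> closure \<Omega>" "y \<in> \<Omega>" "x \<noteq> y" for x y
    using bd[OF that] by (rule order_trans) (auto intro: mult_right_mono)
  show ?thesis
  proof (cases "0 \<le> \<alpha>")
    case True
    have "weakly_singular_kernel \<Omega> G \<bar>A\<bar> \<alpha>"
      by standard (use \<Omega> \<alpha> cont bd' True in auto)
    then show ?thesis
      by (rule that)
  next
    case False
    obtain R where R: "\<And>x y. x \<in> closure \<Omega> \<Longrightarrow> y \<in> closure \<Omega> \<Longrightarrow> dist x y \<le> R"
      using bounded_closure[OF \<Omega>(2)] unfolding bounded_two_points by blast
    have "weakly_singular_kernel \<Omega> G (\<bar>A\<bar> * R powr (- \<alpha>)) 0"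
    proof
      fix x y assume xy: "x \<in> closure \<Omega>" "y \<in> \<Omega>" "x \<noteq> y"
      have "\<bar>G x y\<bar> \<le> \<bar>A\<bar> * dist x y powr (- \<alpha>)"
        using xy by (rule bd')
      also have "\<dots> \<le> \<bar>A\<bar> * R powr (- \<alpha>)"
        using R[OF xy(1) subsetD[OF closure_subset xy(2)]] False
        by (intro mult_left_mono powr_mono2) auto
      finally show "\<bar>G x y\<bar> \<le> \<bar>A\<bar> * R powr (- \<alpha>) * dist x y powr (- 0)"
        using xy by simp
    qed (use \<Omega> cont in auto)
    then show ?thesis
      by (rule that)
  qed
qed

text \<open>The left-hand side is \<open>K \<mu> r\<close>, an upper bound for \<open>b\<^sub>1\<close>.\<close>

lemma radius_le:
  fixes C :: real
  assumes "0 < C"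
  shows "(sqrt (16 * C\<^sup>2 + 1) - 4 * C) / 2 \<le> 1 / (16 * C)"
proof -
  have "sqrt (16 * C\<^sup>2 + 1) \<le> 4 * C + 1 / (8 * C)"
  proof (rule real_le_lsqrt)
    have "(4 * C + 1 / (8 * C))\<^sup>2 = 16 * C\<^sup>2 + 1 + 1 / (64 * C\<^sup>2)"
      using assms by (simp add: power2_eq_square field_simps)
    then show "16 * C\<^sup>2 + 1 \<le> (4 * C + 1 / (8 * C))\<^sup>2"
      by simp
  qed (use assms in auto)
  then show ?thesis
    using assms by (simp add: field_simps)
qed

text \<open>The map \<open>y \<mapsto> y - C y\<^sup>2 / (1 - y)\<close> is close to \<open>y - C y\<^sup>2\<close> for small \<open>y\<close>, and the round value
  \<open>y = 1 / (4 C)\<close> already makes it exceed \<open>1 / (16 C)\<close>; \<open>C \<ge> 2\<close> keeps \<open>1 - y\<close> away from \<open>0\<close>.\<close>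

lemma supersolution:
  fixes C :: real
  assumes C: "2 \<le> C"
  defines "y \<equiv> 1 / (4 * C)"
  shows "1 / (16 * C) + C * (y\<^sup>2 / (1 - y)) \<le> y"
proof -
  have "C * (y\<^sup>2 / (1 - y)) = 1 / (4 * (4 * C - 1))"
    using C by (simp add: y_def power2_eq_square divide_simps)
  also have "\<dots> \<le> 1 / (14 * C)"
    using C by (intro divide_left_mono) auto
  finally have "1 / (16 * C) + C * (y\<^sup>2 / (1 - y)) \<le> (1 / 16 + 1 / 14) * (1 / C)"
    by (simp add: algebra_simps)
  also have "\<dots> \<le> 1 / 4 * (1 / C)"
    using C by (intro mult_right_mono) auto
  finally show ?thesis
    by (simp add: y_def)
qed

theorem mainTheorem7:
  fixes \<Omega> :: "'a::euclidean_space set"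
    and k :: real
    and G :: "'a \<Rightarrow> 'a \<Rightarrow> real"
    and L :: nat
    and g :: "'a \<Rightarrow> 'a \<Rightarrow> real"
    and u0 :: "'a \<times> 'a \<Rightarrow> real"
    and K1p :: "('a \<times> 'a \<Rightarrow> real) \<Rightarrow> 'a coeffs"
    and \<phi> :: "'a \<times> 'a \<Rightarrow> real"
    and Q :: "real \<Rightarrow> real"
    and U \<mu> \<nu> K C r :: real
  assumes dim: "2 \<le> DIM('a)"
    and domain: "smooth_bounded_domain \<Omega>"
    and nonresonance: "\<not> neumann_eigenvalue \<Omega> (- k\<^sup>2)"
    and green: "neumann_green \<Omega> k G"
    and L: "2 \<le> L"
    and u0_cont: "continuous_on (closure \<Omega> \<times> frontier \<Omega>) u0"
    and u0_solves: "\<And>s. s \<in> frontier \<Omega> \<Longrightarrow> solves_linear_problem \<Omega> k (g s) (\<lambda>x. u0 (x, s))"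
    and u0_nonzero: "\<exists>p \<in> closure \<Omega> \<times> frontier \<Omega>. u0 p \<noteq> 0"
    and pseudoinverse: "bounded_linear_C_Linf \<Omega> L K1p"
    and data: "continuous_on (frontier \<Omega> \<times> frontier \<Omega>) \<phi>"
    and Q: "\<And>x. Q x = (\<Sum>l=2..L. x ^ l)"
    and U: "U = C_norm (closure \<Omega> \<times> frontier \<Omega>) u0"
    and \<mu>: "\<mu> = k\<^sup>2 * (SUP x\<in>\<Omega>. LINT y|lebesgue_on \<Omega>. \<bar>G x y\<bar>)"
    and \<nu>: "\<nu> = real L / (real L - 1) * U"
    and K: "K = (real L - 1) * (Q (real L / (real L - 1) * U) / U)"
    and C: "C = max 2 (op_norm_C_Linf \<Omega> L K1p * \<nu> * K * \<mu>)"
    and r: "r = 1 / (2 * K * \<mu>) * (sqrt (16 * C\<^sup>2 + 1) - 4 * C)"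
    and small: "Linf_norm \<Omega> L (K1p \<phi>) < r"
  shows "Linf_series_converges \<Omega> L (\<lambda>m. inv_born_op \<Omega> k G L u0 K1p m \<phi>)"
proof -
  from domain have \<Omega>: "open \<Omega>" "bounded \<Omega>" "\<Omega> \<noteq> {}"
    by (auto simp: smooth_bounded_domain_def)
  obtain A \<alpha> where "weakly_singular_kernel \<Omega> G A \<alpha>"
    using \<Omega>(1,2) green by (rule neumann_green_weakly_singular)
  then interpret weakly_singular_kernel \<Omega> G A \<alpha> .
  interpret born_setting \<Omega> G A \<alpha> L k u0 U \<mu>
    by standard (use \<Omega> L u0_cont u0_nonzero U \<mu> in auto)
  let ?a = "\<lambda>m. N (inv_born_op \<Omega> k G L u0 K1p m \<phi>)"
  let ?\<tau> = "op_norm_C_Linf \<Omega> L K1p"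
  note mem = inv_op_in_Linf[OF pseudoinverse data]
  have a_nonneg: "0 \<le> ?a m" for m
    using mem by (rule Linf_norm_nonneg)
  have L': "0 < real L - 1"
    using L by simp
  have U_pos: "0 < U"
    using u0_nonzero abs_u0_le by force
  have \<nu>_pos: "0 < \<nu>"
    using U_pos L' L by (simp add: \<nu>)
  have Q_pos: "0 < Q \<nu>"
    unfolding Q using \<nu>_pos L by (intro sum_pos) auto
  have K': "K = (real L - 1) * (Q \<nu> / U)"
    unfolding K \<nu> ..
  have K_pos: "0 < K"
    unfolding K' using L' Q_pos U_pos by simp
  \<comment> \<open>For \<open>\<mu> = 0\<close> the division by zero makes \<open>r = 0\<close>, and no \<open>\<phi>\<close> satisfies the hypothesis.\<close>
  have "\<mu> \<noteq> 0"
    using a_nonneg[of "Suc 0"] small by (auto simp: r)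
  then have \<mu>_pos: "0 < \<mu>"
    using \<mu>_nonneg by simp
  let ?s = "K * \<mu>"
  have s_pos: "0 < ?s"
    using K_pos \<mu>_pos by simp

  \<comment> \<open>The choice of \<open>K\<close>: with \<open>x = 1 / (K \<mu>)\<close> the second summand equals \<open>U / (L - 1)\<close>, and
    \<open>U + U / (L - 1) = \<nu>\<close>.\<close>
  have fix_point: "U + 1 / ?s * \<mu> * (\<Sum>l=2..L. \<nu> ^ l) \<le> \<nu>"
  proof -
    have "1 / ?s * \<mu> * Q \<nu> = U / (real L - 1)"
      using \<mu>_pos Q_pos L' U_pos by (simp add: K')
    moreover have "U + U / (real L - 1) = \<nu>"
      using L' by (simp add: \<nu> field_simps)
    ultimately show ?thesis
      by (simp add: Q)
  qed
  have "U \<le> \<nu>"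
    using L' U_pos by (simp add: \<nu> field_simps)
  with fix_point have maj: "majorant L \<mu> U n \<le> \<nu> * ?s ^ n" for n
    using majorant_le[where x = "1 / ?s" and L = L and V = \<nu> and n = n, OF \<mu>_nonneg U_nonneg] s_pos by simp

  let ?b = "\<lambda>m. ?s * ?a m"
  have b_nonneg: "0 \<le> ?b m" for m
    using a_nonneg s_pos by simp
  have rec: "?b m \<le> C * (\<Sum>n=2..m. \<Sum>is\<in>pos_index_tuples n m. prod_list (map ?b is))"
    if m: "2 \<le> m" for m
  proof -
    let ?P = "\<lambda>n. \<Sum>is\<in>pos_index_tuples n m. prod_list (map ?a is)"
    have P: "0 \<le> ?P n" for n
      using a_nonneg by (intro sum_nonneg prod_list_nonneg) auto
    have "?b m \<le> ?s * (?\<tau> * (\<Sum>n=2..m. \<Sum>is\<in>pos_index_tuples n m. majorant L \<mu> U n * prod_list (map ?a is)))"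
      using inv_op_norm_le[OF pseudoinverse data m] s_pos by (intro mult_left_mono) auto
    also have "\<dots> = ?s * (?\<tau> * (\<Sum>n=2..m. majorant L \<mu> U n * ?P n))"
      by (simp only: sum_distrib_left)
    also have "\<dots> \<le> ?s * (?\<tau> * (\<Sum>n=2..m. \<nu> * ?s ^ n * ?P n))"
      using s_pos op_norm_nonneg[OF pseudoinverse data] P
      by (intro mult_left_mono sum_mono mult_right_mono maj) auto
    also have "\<dots> = (?\<tau> * \<nu> * K * \<mu>) * (\<Sum>n=2..m. ?s ^ n * ?P n)"
      by (simp add: sum_distrib_left mult_ac)
    also have "\<dots> \<le> C * (\<Sum>n=2..m. ?s ^ n * ?P n)"
      using P s_pos by (intro mult_right_mono sum_nonneg) (auto simp: C)
    also have "(\<Sum>n=2..m. ?s ^ n * ?P n) =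
        (\<Sum>n=2..m. \<Sum>is\<in>pos_index_tuples n m. prod_list (map ?b is))"
    proof (rule sum.cong[OF refl])
      fix n
      have "prod_list (map ?b is) = ?s ^ length is * prod_list (map ?a is)" for "is"
        by (induction "is") (auto simp: mult_ac)
      then show "?s ^ n * ?P n = (\<Sum>is\<in>pos_index_tuples n m. prod_list (map ?b is))"
        unfolding sum_distrib_left by (intro sum.cong) (auto simp: pos_index_tuples_def)
    qed
    finally show ?thesis .
  qed

  have C2: "2 \<le> C"
    by (simp add: C)
  define y where "y = 1 / (4 * C)"
  have "?b 1 \<le> ?s * r"
    using small s_pos by (intro mult_left_mono) auto
  also have "?s * r = (sqrt (16 * C\<^sup>2 + 1) - 4 * C) / 2"
    using K_pos \<mu>_pos by (simp add: r)
  also have "\<dots> \<le> 1 / (16 * C)"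
    using C2 by (intro radius_le) simp
  finally have "?b 1 + C * (y\<^sup>2 / (1 - y)) \<le> y"
    using supersolution[OF C2] by (simp add: y_def)
  moreover have "0 \<le> y" "y < 1" "0 \<le> C"
    using C2 by (auto simp: y_def)
  ultimately have "(\<Sum>m=1..M. ?b m) \<le> y" for M
    using inverse_majorant_partial_sum_le[OF b_nonneg _ rec] by blast
  then have "(\<Sum>m=1..M. ?a m) \<le> y / ?s" for M
    using s_pos by (simp add: sum_distrib_left[symmetric] field_simps)
  then show ?thesis
    by (rule Linf_series_convergesI[OF mem])
qed

end
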